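(* Let $n\ge2$, $1\le m<n$, $k\ge2$ be integers, let $\Sigma\subset\mathbb{R}^n$ be a compact $m$-dimensional $C^k$ submanifold and $\varepsilon>0$. Then for every $R\ge C_{\Sigma,\varepsilon}$ there is an $m$-dimensional $C^k$ submanifold $\Sigma'_R$ within $\varepsilon$ of $\Sigma$ in the $C^k$ topology which contains at least $c_{\Sigma,\varepsilon}R^{\frac{mn}{m+k(n-m)}}$ points of the lattice $(\tfrac1R\mathbb{Z})^n$, where $C_{\Sigma,\varepsilon},c_{\Sigma,\varepsilon}>0$ depend only on $\Sigma,\varepsilon$ (and $n,m,k$). *)

theory Defs
  imports "HOL-Analysis.Analysis"
begin

text \<open>Partial derivative of a map on real vectors in coordinate direction i
 (meaningful where the map is differentiable).\<close>
definition partial_deriv :: "'n::finite \<Rightarrow> (real^'n \<Rightarrow> real^'m) \<Rightarrow> real^'n \<Rightarrow> real^'m" where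
  "partial_deriv i f x = frechet_derivative f (at x) (axis i 1)"

fun Ck_on :: "nat \<Rightarrow> (real^'n::finite) set \<Rightarrow> (real^'n \<Rightarrow> real^'m::finite) \<Rightarrow> bool" where
  "Ck_on 0 U f = continuous_on U f"
| "Ck_on (Suc k) U f =
     (continuous_on U f \<and> (\<forall>x\<in>U. f differentiable (at x)) \<and>
      (\<forall>i. Ck_on k U (partial_deriv i f)))"

fun iter_partial :: "'n::finite list \<Rightarrow> (real^'n \<Rightarrow> real^'m) \<Rightarrow> real^'n \<Rightarrow> real^'m" where
  "iter_partial [] f = f"
| "iter_partial (i # is) f = iter_partial is (partial_deriv i f)"

definition Ck_diffeo_on :: "nat \<Rightarrow> (real^'n::finite) set \<Rightarrow> (real^'n) set \<Rightarrow> (real^'n \<Rightarrow> real^'n) \<Rightarrow> bool" where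
  "Ck_diffeo_on k U V \<phi> \<longleftrightarrow> open U \<and> open V \<and> Ck_on k U \<phi> \<and> inj_on \<phi> U \<and> \<phi> ` U = V \<and>
      Ck_on k V (inv_into U \<phi>)"

definition Ck_submanifold :: "nat \<Rightarrow> nat \<Rightarrow> (real^'n::finite) set \<Rightarrow> bool" where
  "Ck_submanifold k m S \<longleftrightarrow>
     (\<forall>p\<in>S. \<exists>U V \<phi> L. p \<in> U \<and> Ck_diffeo_on k U V \<phi> \<and> subspace L \<and> dim L = m \<and>
                  \<phi> ` (U \<inter> S) = V \<inter> L)"

text \<open>S' is within eps of S in the C^k topology: S' is the image of S under a
 C^k diffeomorphism Phi of R^n whose C^k distance to the identity (sup over R^n of all
 partial derivatives of Phi - id of order 0..k) is less than eps.\<close>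
definition Ck_close :: "nat \<Rightarrow> real \<Rightarrow> (real^'n::finite) set \<Rightarrow> (real^'n) set \<Rightarrow> bool" where
  "Ck_close k eps S S' \<longleftrightarrow>
     (\<exists>\<Phi> \<delta>. \<delta> < eps \<and> Ck_diffeo_on k UNIV UNIV \<Phi> \<and> S' = \<Phi> ` S \<and>
        (\<forall>is x. length is \<le> k \<longrightarrow> norm (iter_partial is (\<lambda>y. \<Phi> y - y) x) \<le> \<delta>))"

definition scaled_lattice :: "real \<Rightarrow> (real^'n::finite) set" where
  "scaled_lattice R = {x. \<forall>i. R * x $ i \<in> \<int>}"

end

theory Submission
  imports Defs
begin

text \<open>Some coordinate projection of \<open>\<Sigma>\<close> onto \<open>\<real>\<^sup>I\<close>, \<open>card I = m\<close>, contains a box; call the other coordinates \<open>J\<close>.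
All perturbations are shears \<open>x \<mapsto> x + G (x\<^sub>I)\<close> with \<open>G\<close> valued in \<open>\<real>\<^sup>J\<close>, so their inverses are explicit.
The box is cut into cells with \<open>w\<^sup>m\<close> candidate lattice points of \<open>\<real>\<^sup>I\<close> each. Over a candidate \<open>q\<close>
the point of \<open>\<Sigma>\<close> becomes a lattice point after a bump of height \<open>1/(LR)\<close> as soon as its \<open>J\<close>-coordinates are within
\<open>1/(LR)\<close> of the lattice. Adding a random translation of size \<open>1/R\<close> and a random small multiple of
\<open>sin (x\<^sub>l - c\<^sub>l)\<close> in every \<open>l \<in> I\<close> makes these events almost pairwise independent of probability \<open>L\<^sup>-\<^sup>d\<close>,
\<open>d = n - m\<close>, so if \<open>L\<^sup>d\<close> is comparable to \<open>w\<^sup>m\<close>, a second moment estimate yields a positive proportion of cells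
with a good candidate. The bumps have radius about \<open>w/R\<close>; they are small in \<open>C\<^sup>k\<close> if
\<open>L w\<^sup>k\<close> dominates \<open>R\<^bsup>k-1\<^esup>\<close>, which leads to \<open>w\<close> of order \<open>R\<^bsup>(k-1)d/(kd+m)\<^esup>\<close> and
to about \<open>(R/w)\<^sup>m\<close> lattice points.\<close>

subsection \<open>Calculus of \<open>C\<^sup>k\<close> maps\<close>

lemma has_derivative_partial_deriv:
  "(f has_derivative f') (at x) \<Longrightarrow> partial_deriv i f x = f' (axis i 1)"
  unfolding partial_deriv_def by (metis frechet_derivative_at)

lemma partial_deriv_cong:
  assumes "open U" "x \<in> U" "\<And>y. y \<in> U \<Longrightarrow> f y = g y"
  shows "partial_deriv i f x = partial_deriv i g x"
proof -
  have "(f has_derivative f') (at x) \<longleftrightarrow> (g has_derivative f') (at x)" for f'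
    using has_derivative_transform_within_open[of f f' x UNIV U g]
      has_derivative_transform_within_open[of g f' x UNIV U f] assms by auto
  then show ?thesis
    unfolding partial_deriv_def frechet_derivative_def by simp
qed

text \<open>On an open set a derivative only sees nearby values. The inductions below use this to
  replace \<open>partial_deriv\<close> by a formula that is known on \<open>U\<close> only.\<close>

lemma Ck_on_cong:
  assumes "open U" "\<And>y. y \<in> U \<Longrightarrow> f y = g y" "Ck_on k U f"
  shows "Ck_on k U g"
  using assms(2,3)
proof (induction k arbitrary: f g)
  case 0
  then show ?case using continuous_on_cong[of U U f g] by auto
next
  case (Suc k)
  have "continuous_on U g" using Suc.prems continuous_on_cong[of U U f g] by auto
  moreover have "g differentiable (at x)" if "x \<in> U" for x
    using Suc.prems that has_derivative_transform_within_open[of f _ x UNIV U g] assms(1)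
    by (auto simp: differentiable_def) blast
  moreover have "Ck_on k U (partial_deriv i g)" for i
    by (rule Suc.IH[of "partial_deriv i f"])
       (use Suc.prems partial_deriv_cong[OF assms(1), of _ f g] in auto)
  ultimately show ?case by simp
qed

lemma Ck_on_continuous: "Ck_on k U f \<Longrightarrow> continuous_on U f"
  by (cases k) auto

lemma Ck_on_SucD: "Ck_on (Suc k) U f \<Longrightarrow> Ck_on k U f"
proof (induction k arbitrary: f)
  case (Suc k)
  then show ?case by (metis Ck_on.simps(2))
qed auto

lemma Ck_on_subset: "Ck_on k U f \<Longrightarrow> V \<subseteq> U \<Longrightarrow> Ck_on k V f"
  by (induction k arbitrary: f) (auto intro: continuous_on_subset)

lemma Ck_on_const: "Ck_on k (U :: (real^'a::finite) set) (\<lambda>x. c)"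
proof (induction k arbitrary: c)
  case (Suc k)
  have "partial_deriv i (\<lambda>x. c) = (\<lambda>x. 0)" for i :: 'a
    by (rule ext, subst has_derivative_partial_deriv[OF has_derivative_const]) auto
  then show ?case using Suc by auto
qed auto

lemma Ck_on_ident: "Ck_on k U (\<lambda>x. x)"
proof (cases k)
  case (Suc j)
  have "partial_deriv i (\<lambda>x. x) = (\<lambda>x. axis i 1)" for i :: 'a
    by (rule ext, subst has_derivative_partial_deriv[OF has_derivative_ident]) auto
  then show ?thesis using Suc by (auto intro: Ck_on_const)
qed auto

lemma Ck_on_add:
  assumes "open U"
  shows "Ck_on k U f \<Longrightarrow> Ck_on k U g \<Longrightarrow> Ck_on k U (\<lambda>x. f x + g x)"
proof (induction k arbitrary: f g)
  case 0
  then show ?case by (simp add: continuous_on_add)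
next
  case (Suc k)
  have d: "partial_deriv i f x + partial_deriv i g x = partial_deriv i (\<lambda>x. f x + g x) x"
    if "x \<in> U" for x i
  proof -
    have "f differentiable (at x)" "g differentiable (at x)" using Suc.prems that by auto
    then have "((\<lambda>x. f x + g x) has_derivative
       (\<lambda>y. frechet_derivative f (at x) y + frechet_derivative g (at x) y)) (at x)"
      by (intro has_derivative_add) (auto simp: frechet_derivative_works)
    then show ?thesis by (simp add: has_derivative_partial_deriv) (simp add: partial_deriv_def)
  qed
  have "Ck_on k U (partial_deriv i (\<lambda>x. f x + g x))" for i
    by (rule Ck_on_cong[OF assms d Suc.IH]) (use Suc.prems in auto)
  then show ?case using Suc.prems by (simp add: continuous_on_add differentiable_add)
qed

lemma Ck_on_sum:
  assumes "open U" "finite S" "\<And>t. t \<in> S \<Longrightarrow> Ck_on k U (f t)"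
  shows "Ck_on k U (\<lambda>x. \<Sum>t\<in>S. f t x)"
  using assms(2,3) by (induction S) (auto intro: Ck_on_const Ck_on_add[OF assms(1)])

lemma has_derivative_component_scaleR:
  fixes f :: "real^'a::finite \<Rightarrow> real^'b::finite" and h :: "real^'a \<Rightarrow> real^'c::finite"
  assumes "(f has_derivative f') (at x)" "(h has_derivative h') (at x)"
  shows "((\<lambda>x. f x $ j *\<^sub>R h x) has_derivative (\<lambda>y. f x $ j *\<^sub>R h' y + f' y $ j *\<^sub>R h x)) (at x)"
  by (rule has_derivative_scaleR[OF _ assms(2)])
     (rule bounded_linear.has_derivative[OF bounded_linear_vec_nth assms(1)])

text \<open>This is the shape of the terms in the chain rule. \<open>Ck_on\<close> speaks of
  vector-valued maps, so a scalar factor enters as a component of one. The product rule yields two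
  terms of the same shape, hence the induction varies both factors.\<close>

lemma Ck_on_component_scaleR:
  assumes "open U"
  shows "Ck_on k U f \<Longrightarrow> Ck_on k U h \<Longrightarrow> Ck_on k U (\<lambda>x. f x $ j *\<^sub>R h x)"
proof (induction k arbitrary: f h)
  case 0
  then show ?case by (simp add: continuous_on_scaleR continuous_on_component)
next
  case (Suc k)
  have D: "((\<lambda>x. f x $ j *\<^sub>R h x) has_derivative (\<lambda>y. f x $ j *\<^sub>R frechet_derivative h (at x) y
        + frechet_derivative f (at x) y $ j *\<^sub>R h x)) (at x)" if "x \<in> U" for x
    using Suc.prems that
    by (intro has_derivative_component_scaleR) (auto simp: frechet_derivative_works[symmetric])
  have d: "f x $ j *\<^sub>R partial_deriv i h x + partial_deriv i f x $ j *\<^sub>R h x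
      = partial_deriv i (\<lambda>x. f x $ j *\<^sub>R h x) x" if "x \<in> U" for x i
    using has_derivative_partial_deriv[OF D[OF that], of i] by (simp add: partial_deriv_def)
  have "Ck_on k U (partial_deriv i (\<lambda>x. f x $ j *\<^sub>R h x))" for i
    by (rule Ck_on_cong[OF assms d], assumption, rule Ck_on_add[OF assms]; rule Suc.IH)
       (use Suc.prems[THEN Ck_on_SucD] Suc.prems in simp_all)
  moreover have "(\<lambda>x. f x $ j *\<^sub>R h x) differentiable (at x)" if "x \<in> U" for x
    using D[OF that] by (auto simp: differentiable_def)
  ultimately show ?case using Suc.prems by (simp add: continuous_on_scaleR continuous_on_component)
qed

lemma linear_axis_expansion:
  fixes f :: "real^'a::finite \<Rightarrow> real^'b::finite"
  assumes "linear f"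
  shows "f y = (\<Sum>j\<in>UNIV. y $ j *\<^sub>R f (axis j 1))"
proof -
  have "f y = f (\<Sum>j\<in>UNIV. y $ j *\<^sub>R axis j 1)"
    using basis_expansion[of y] by (simp add: scalar_mult_eq_scaleR)
  then show ?thesis by (simp add: linear_sum[OF assms] linear_scale[OF assms])
qed

text \<open>In coordinates the chain rule gives a finite sum of products. The induction hypothesis
  applies to \<open>partial_deriv j f\<close> in place of \<open>f\<close>, while \<open>g\<close>
  stays fixed and gives up one order of regularity.\<close>

lemma Ck_on_compose:
  assumes "open U" "open V"
  shows "Ck_on k U f \<Longrightarrow> Ck_on k V g \<Longrightarrow> g ` V \<subseteq> U \<Longrightarrow> Ck_on k V (\<lambda>x. f (g x))"
proof (induction k arbitrary: f)
  case 0
  then show ?case by (auto intro: continuous_on_compose2)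
next
  case (Suc k)
  have D: "((\<lambda>x. f (g x)) has_derivative
      (\<lambda>y. frechet_derivative f (at (g x)) (frechet_derivative g (at x) y))) (at x)"
    if "x \<in> V" for x
  proof -
    have "f differentiable (at (g x))" "g differentiable (at x)" using Suc.prems that by auto
    then show ?thesis
      using has_derivative_compose[of g _ x UNIV f] by (auto simp: frechet_derivative_works)
  qed
  have d: "(\<Sum>j\<in>UNIV. partial_deriv i g x $ j *\<^sub>R partial_deriv j f (g x))
      = partial_deriv i (\<lambda>x. f (g x)) x" if "x \<in> V" for x i
  proof -
    have "linear (frechet_derivative f (at (g x)))"
      using Suc.prems that by (auto intro: linear_frechet_derivative)
    from linear_axis_expansion[OF this, of "frechet_derivative g (at x) (axis i 1)"]
    show ?thesis
      using has_derivative_partial_deriv[OF D[OF that], of i] by (simp add: partial_deriv_def)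
  qed
  have "Ck_on k V (partial_deriv i (\<lambda>x. f (g x)))" for i
    by (rule Ck_on_cong[OF assms(2) d], assumption, intro Ck_on_sum Ck_on_component_scaleR assms finite Suc.IH)
       (use Suc.prems(2)[THEN Ck_on_SucD] Suc.prems in simp_all)
  moreover have "(\<lambda>x. f (g x)) differentiable (at x)" if "x \<in> V" for x
    using D[OF that] by (auto simp: differentiable_def)
  moreover have "continuous_on V (\<lambda>x. f (g x))"
    using Suc.prems by (auto intro: continuous_on_compose2)
  ultimately show ?case by simp
qed

text \<open>A chart \<open>\<phi>\<close> on \<open>U\<close> is carried to \<open>\<phi>\<close>
  after \<open>\<Psi>\<close> on the image of \<open>U\<close> under \<open>\<Phi>\<close>; the
  inverse of the new chart is \<open>\<Phi>\<close> after the inverse of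
  \<open>\<phi>\<close>.\<close>

lemma Ck_submanifold_image:
  fixes S :: "(real^'n::finite) set"
  assumes S: "Ck_submanifold k m S" and \<Phi>: "Ck_diffeo_on k UNIV UNIV \<Phi>"
  shows "Ck_submanifold k m (\<Phi> ` S)"
  unfolding Ck_submanifold_def
proof
  fix p assume "p \<in> \<Phi> ` S"
  then obtain s where s: "s \<in> S" "p = \<Phi> s" by auto
  obtain U V \<phi> L where c: "s \<in> U" "Ck_diffeo_on k U V \<phi>" "subspace L" "dim L = m"
      "\<phi> ` (U \<inter> S) = V \<inter> L"
    using S s unfolding Ck_submanifold_def by blast
  define \<Psi> where "\<Psi> = inv_into UNIV \<Phi>"
  have P: "Ck_on k UNIV \<Phi>" "Ck_on k UNIV \<Psi>" "inj \<Phi>" "surj \<Phi>"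
    using \<Phi> by (auto simp: Ck_diffeo_on_def \<Psi>_def)
  have inv [simp]: "\<Psi> (\<Phi> x) = x" "\<Phi> (\<Psi> x) = x" for x
    using P by (auto simp: \<Psi>_def surj_f_inv_f)
  have C: "open U" "open V" "Ck_on k U \<phi>" "inj_on \<phi> U" "\<phi> ` U = V" "Ck_on k V (inv_into U \<phi>)"
    using c by (auto simp: Ck_diffeo_on_def)
  \<comment> \<open>As a preimage under the continuous inverse, the image of \<open>U\<close> is
    open.\<close>
  have im: "\<Phi> ` U = \<Psi> -` U" by (force simp: image_iff intro: inv(2)[symmetric])
  have o: "open (\<Phi> ` U)"
    unfolding im using P(2)[THEN Ck_on_continuous] C(1) by (simp add: continuous_on_open_vimage)
  have inj: "inj_on (\<lambda>x. \<phi> (\<Psi> x)) (\<Phi> ` U)"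
    using C(4) by (auto simp: inj_on_def)
  have iv: "\<Phi> (inv_into U \<phi> y) = inv_into (\<Phi> ` U) (\<lambda>x. \<phi> (\<Psi> x)) y" if y: "y \<in> V" for y
  proof (rule sym, rule inv_into_f_eq[OF inj])
    show "\<Phi> (inv_into U \<phi> y) \<in> \<Phi> ` U" using y C(5) by (auto intro: inv_into_into)
    show "\<phi> (\<Psi> (\<Phi> (inv_into U \<phi> y))) = y" using y C(5) by (simp add: f_inv_into_f)
  qed
  have "Ck_on k (\<Phi> ` U) (\<lambda>x. \<phi> (\<Psi> x))"
    by (rule Ck_on_compose[OF C(1) o C(3) Ck_on_subset[OF P(2)]]) auto
  moreover have "Ck_on k V (inv_into (\<Phi> ` U) (\<lambda>x. \<phi> (\<Psi> x)))"
    by (rule Ck_on_cong[OF C(2) iv], assumption, rule Ck_on_compose[OF open_UNIV C(2) P(1) C(6)]) auto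
  moreover have "(\<lambda>x. \<phi> (\<Psi> x)) ` (\<Phi> ` U) = V" using C(5) by (force simp: image_image)
  ultimately have "Ck_diffeo_on k (\<Phi> ` U) V (\<lambda>x. \<phi> (\<Psi> x))"
    using o C(2) inj by (simp add: Ck_diffeo_on_def)
  moreover have "(\<lambda>x. \<phi> (\<Psi> x)) ` (\<Phi> ` U \<inter> \<Phi> ` S) = V \<inter> L"
    using c(5) P(3) by (simp add: image_Int[symmetric] image_image)
  moreover have "p \<in> \<Phi> ` U" using s c by auto
  ultimately show "\<exists>U V \<phi> L. p \<in> U \<and> Ck_diffeo_on k U V \<phi> \<and> subspace L \<and> dim L = m \<and>
      \<phi> ` (U \<inter> \<Phi> ` S) = V \<inter> L"
    using c(3,4) by blast
qed

subsection \<open>Sums of products of one-variable functions\<close>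

text \<open>\<open>u t l i\<close> stands for the \<open>i\<close>-th derivative of the factor in coordinate \<open>l\<close> of the term \<open>t\<close>,
 and \<open>c\<close> records how often each coordinate has been differentiated.\<close>

definition sep_sum :: "('t \<Rightarrow> 'n::finite \<Rightarrow> nat \<Rightarrow> real \<Rightarrow> real) \<Rightarrow> ('t \<Rightarrow> real^'n) \<Rightarrow> 't set \<Rightarrow>
    ('n \<Rightarrow> nat) \<Rightarrow> real^'n \<Rightarrow> real^'n" where
  "sep_sum u v S c x = (\<Sum>t\<in>S. (\<Prod>l\<in>UNIV. u t l (c l) (x $ l)) *\<^sub>R v t)"

lemma le_sum_UNIV: "c l \<le> sum c UNIV" for c :: "'n::finite \<Rightarrow> nat"
  by (rule member_le_sum) auto

lemma sum_upd_Suc: "sum (c(i := Suc (c i))) UNIV = Suc (sum c UNIV)" for c :: "'n::finite \<Rightarrow> nat"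
proof -
  have "sum (c(i := Suc (c i))) UNIV = Suc (c i) + sum (c(i := Suc (c i))) (UNIV - {i})"
    by (subst sum.remove[of _ i]) auto
  also have "sum (c(i := Suc (c i))) (UNIV - {i}) = sum c (UNIV - {i})" by (rule sum.cong) auto
  finally show ?thesis by (simp add: sum.remove[of UNIV i c])
qed

context
  fixes u :: "'t \<Rightarrow> 'n::finite \<Rightarrow> nat \<Rightarrow> real \<Rightarrow> real" and v :: "'t \<Rightarrow> real^'n" and S :: "'t set" and k :: nat
  assumes deriv: "\<And>t l j x. t \<in> S \<Longrightarrow> j < k \<Longrightarrow> (u t l j has_real_derivative u t l (Suc j) x) (at x)"
    and cont: "\<And>t l. t \<in> S \<Longrightarrow> continuous_on UNIV (u t l k)"
begin

lemma sep_sum_has_derivative: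
  assumes c: "\<And>l. c l < k"
  shows "(sep_sum u v S c has_derivative (\<lambda>y. \<Sum>t\<in>S. (\<Sum>l\<in>UNIV. u t l (Suc (c l)) (x $ l) * y $ l *
      (\<Prod>j\<in>UNIV - {l}. u t j (c j) (x $ j))) *\<^sub>R v t)) (at x)"
proof -
  have "((\<lambda>x. u t l (c l) (x $ l)) has_derivative (\<lambda>y. u t l (Suc (c l)) (x $ l) * y $ l)) (at x)"
    if "t \<in> S" for t l
    using has_derivative_compose[OF bounded_linear.has_derivative[OF bounded_linear_vec_nth has_derivative_ident]
        deriv[OF that c, unfolded has_field_derivative_def]] .
  then show ?thesis
    unfolding sep_sum_def
    by (intro has_derivative_sum has_derivative_scaleR_left has_derivative_prod) auto
qed

text \<open>Of the summands of the product rule, \<open>axis i 1\<close> keeps only the one that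
  differentiates the factor in coordinate \<open>i\<close>.\<close>

lemma partial_deriv_sep_sum:
  assumes c: "\<And>l. c l < k"
  shows "partial_deriv i (sep_sum u v S c) = sep_sum u v S (c(i := Suc (c i)))"
proof
  fix x :: "real^'n"
  have eq: "(\<Sum>l\<in>UNIV. u t l (Suc (c l)) (x $ l) * axis i 1 $ l * (\<Prod>j\<in>UNIV - {l}. u t j (c j) (x $ j)))
     = (\<Prod>l\<in>UNIV. u t l ((c(i := Suc (c i))) l) (x $ l))" for t
  proof -
    have "(\<Prod>l\<in>UNIV. u t l ((c(i := Suc (c i))) l) (x $ l))
       = u t i (Suc (c i)) (x $ i) * (\<Prod>j\<in>UNIV - {i}. u t j ((c(i := Suc (c i))) j) (x $ j))"
      by (subst prod.remove[of _ i]) auto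
    also have "(\<Prod>j\<in>UNIV - {i}. u t j ((c(i := Suc (c i))) j) (x $ j)) = (\<Prod>j\<in>UNIV - {i}. u t j (c j) (x $ j))"
      by (rule prod.cong) auto
    finally show ?thesis by (subst sum.remove[of _ i]) (auto simp: axis_def intro!: sum.neutral)
  qed
  show "partial_deriv i (sep_sum u v S c) x = sep_sum u v S (c(i := Suc (c i))) x"
    unfolding has_derivative_partial_deriv[OF sep_sum_has_derivative[OF c]]
    unfolding sep_sum_def by (simp only: eq)
qed

lemma continuous_sep_sum:
  assumes c: "\<And>l. c l \<le> k"
  shows "continuous_on UNIV (sep_sum u v S c)"
proof -
  have "continuous_on UNIV (u t l (c l))" if "t \<in> S" for t l
  proof (cases "c l < k")
    case True
    then show ?thesis using deriv[OF that] by (meson DERIV_isCont continuous_at_imp_continuous_on)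
  next
    case False
    then show ?thesis using cont[OF that] c[of l] by (metis le_neq_implies_less)
  qed
  then have "continuous_on UNIV (\<lambda>x::real^'n. u t l (c l) (x $ l))" if "t \<in> S" for t l
    using that continuous_on_compose2[of UNIV "u t l (c l)" UNIV "\<lambda>x. x $ l"]
    by (auto simp: continuous_on_component)
  then show ?thesis
    unfolding sep_sum_def by (intro continuous_on_sum continuous_on_scaleR continuous_on_prod continuous_on_const) auto
qed

text \<open>The orders already spent and the \<open>r\<close> still wanted share the budget
  \<open>k\<close>. No single \<open>c l\<close> exceeds the total, so every factor remains
  differentiable often enough.\<close>

lemma Ck_on_sep_sum: "sum c UNIV + r \<le> k \<Longrightarrow> Ck_on r UNIV (sep_sum u v S c)"
proof (induction r arbitrary: c)
  case 0
  have "c l \<le> k" for l using 0 le_sum_UNIV[of c l] by simp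
  then show ?case using continuous_sep_sum by simp
next
  case (Suc r)
  have lt: "c l < k" for l using Suc.prems le_sum_UNIV[of c l] by simp
  have "Ck_on r UNIV (partial_deriv i (sep_sum u v S c))" for i
    unfolding partial_deriv_sep_sum[of c, OF lt] by (rule Suc.IH) (use Suc.prems sum_upd_Suc[of c i] in simp)
  then show ?case
    using continuous_sep_sum[of c, OF less_imp_le[OF lt]] sep_sum_has_derivative[of c, OF lt]
    by (auto simp: differentiable_def)
qed

text \<open>The later bounds depend on the total order only, so it suffices that some multi-index of
  the right total exists.\<close>

lemma iter_partial_sep_sum:
  "sum c UNIV + length is \<le> k \<Longrightarrow> \<exists>c'. sum c' UNIV = sum c UNIV + length is \<and>
     iter_partial is (sep_sum u v S c) = sep_sum u v S c'"
proof (induction "is" arbitrary: c)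
  case (Cons i "is")
  have lt: "c l < k" for l using Cons.prems le_sum_UNIV[of c l] by simp
  show ?case
    using Cons.IH[of "c(i := Suc (c i))"] Cons.prems sum_upd_Suc[of c i]
    by (simp add: partial_deriv_sep_sum[of c, OF lt] del: fun_upd_apply)
qed auto

end

subsection \<open>A \<open>C\<^sup>k\<close> bump\<close>

text \<open>The two pieces are glued along the closures of the interval and of its complement, which
  meet in \<open>-1\<close> and \<open>1\<close>; there both values and both derivatives
  vanish.\<close>

lemma DERIV_poly_truncated:
  fixes p :: "real poly"
  assumes "poly p 1 = 0" "poly p (-1) = 0" "poly (pderiv p) 1 = 0" "poly (pderiv p) (-1) = 0"
  shows "((\<lambda>t. if \<bar>t\<bar> < 1 then poly p t else 0) has_real_derivative
     (if \<bar>t\<bar> < 1 then poly (pderiv p) t else 0)) (at t)"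
proof -
  let ?f = "\<lambda>t. if \<bar>t\<bar> < 1 then poly p t else 0"
  have eq: "?f = (\<lambda>t. if t \<in> {-1..1} then poly p t else 0)"
    using assms(1,2) by (auto simp: fun_eq_iff abs_if)
  have cl: "closure (- {-1..1::real}) = {..-1} \<union> {1..}"
  proof -
    have "- {-1..1::real} = {..<-1} \<union> {1<..}" by auto
    then show ?thesis by (simp add: closure_Un)
  qed
  have "((\<lambda>t. if t \<in> {-1..1} then poly p t else 0) has_derivative
      (if t \<in> {-1..1} then (*) (poly (pderiv p) t) else (\<lambda>_. 0))) (at t within {-1..1} \<union> (- {-1..1}))"
    by (rule has_derivative_If_within_closures)
       (use assms poly_DERIV[of p t] in \<open>auto simp: cl has_field_derivative_def intro: has_derivative_at_withinI\<close>)
  then show ?thesis unfolding eq has_field_derivative_def using assms(3,4)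
    by (auto simp: abs_if split: if_splits elim!: has_derivative_eq_rhs) 
qed

lemma power_dvd_pderiv:
  fixes p q :: "real poly"
  assumes "q ^ Suc j dvd p"
  shows "q ^ j dvd pderiv p"
proof -
  obtain r where "p = q ^ Suc j * r" using assms by (elim dvdE)
  then have "pderiv p = q ^ j * (q * pderiv r + smult (of_nat (Suc j)) (pderiv q * r))"
    by (simp only: pderiv_mult pderiv_power_Suc) (simp add: algebra_simps)
  then show ?thesis by simp
qed

text \<open>The bump is \<open>(1 - t^2)^(k+2)\<close> cut off outside \<open>[-1, 1]\<close>. Its
  derivatives are listed as one sequence \<open>b\<close>, the form in which \<open>sep_sum\<close>
  takes its factors.\<close>

lemma Ck_bump_exists:
  obtains b :: "nat \<Rightarrow> real \<Rightarrow> real" and M :: real where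
    "\<And>j t. j < k \<Longrightarrow> (b j has_real_derivative b (Suc j) t) (at t)"
    "continuous_on UNIV (b k)" "b 0 0 = 1" "\<And>j t. \<bar>t\<bar> \<ge> 1 \<Longrightarrow> b j t = 0"
    "\<And>j t. j \<le> k \<Longrightarrow> \<bar>b j t\<bar> \<le> M" "M \<ge> 1"
proof -
  define q :: "real poly" where "q = [:1, 0, -1:]"
  define p where "p j = (pderiv ^^ j) (q ^ Suc (Suc k))" for j
  have dvd: "q ^ (Suc (Suc k) - j) dvd p j" if "j \<le> Suc k" for j
    using that
  proof (induction j)
    case (Suc j)
    have "q ^ Suc (Suc (Suc k) - Suc j) dvd p j"
      using Suc by (simp add: Suc_diff_le del: power_Suc)
    from power_dvd_pderiv[OF this] show ?case by (simp add: p_def)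
  qed (simp add: p_def)
  have root: "poly (p j) 1 = 0" "poly (p j) (-1) = 0" if "j \<le> Suc k" for j
  proof -
    have "q dvd p j" using dvd[OF that] that
      by (metis Suc_diff_le dvd_power dvd_trans zero_less_Suc)
    then show "poly (p j) 1 = 0" "poly (p j) (-1) = 0" by (auto simp: q_def elim!: dvdE)
  qed
  have pS: "p (Suc j) = pderiv (p j)" for j by (simp add: p_def)
  define b where "b j t = (if \<bar>t\<bar> < 1 then poly (p j) t else 0)" for j t
  \<comment> \<open>Differentiating \<open>b j\<close> needs the roots of \<open>p j\<close> and of
    \<open>p (Suc j)\<close>. The exponent \<open>k + 2\<close> provides them up to
    \<open>j = k\<close>, one order more than demanded, and this makes \<open>b k\<close>
    continuous.\<close>
  have D: "(b j has_real_derivative b (Suc j) t) (at t)" if "j \<le> k" for j t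
    using DERIV_poly_truncated[of "p j" t] root[of j] root[of "Suc j"] that
    unfolding b_def[abs_def] pS by simp
  have "\<exists>M. \<forall>t. \<bar>b j t\<bar> \<le> M" for j
  proof -
    have "compact (poly (p j) ` {-1..1})"
      by (intro compact_continuous_image continuous_intros) auto
    then obtain M where M: "\<forall>x\<in>poly (p j) ` {-1..1}. norm x \<le> M"
      using compact_imp_bounded bounded_iff by metis
    have "\<bar>b j t\<bar> \<le> max M 0" for t
      using M by (auto simp: b_def abs_less_iff intro: max.coboundedI1)
    then show ?thesis by blast
  qed
  then obtain M where M: "\<And>j t. \<bar>b j t\<bar> \<le> M j" by metis
  have M0: "M j \<ge> 0" for j using M[of j 0] by linarith
  show ?thesis
  proof (rule that[of b "1 + sum M {..k}"])
    show "continuous_on UNIV (b k)"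
      using D[of k] by (meson DERIV_isCont continuous_at_imp_continuous_on order_refl)
    show "\<bar>b j t\<bar> \<le> 1 + sum M {..k}" if "j \<le> k" for j t
      using M[of j t] member_le_sum[of j "{..k}" M] that M0 by force
    show "1 \<le> 1 + sum M {..k}" using M0 by (simp add: sum_nonneg)
    show "b 0 0 = 1" by (simp add: b_def p_def q_def)
  qed (use D in \<open>auto simp: b_def\<close>)
qed

subsection \<open>Coordinate projections of submanifolds\<close>

text \<open>A basis of \<open>W\<close> is completed to a basis of the whole space by vectors
  \<open>axis j 1\<close> with \<open>j \<in> J\<close>. Vectors supported on \<open>J\<close> then
  meet \<open>W\<close> in \<open>0\<close> only, so the complement of \<open>J\<close> serves as
  \<open>I\<close>.\<close>

lemma coordinate_complement:
  fixes W :: "(real^'n::finite) set"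
  assumes W: "subspace W"
  obtains I :: "'n set" where "card I = dim W" "\<And>w. w \<in> W \<Longrightarrow> (\<forall>l\<in>I. w $ l = 0) \<Longrightarrow> w = 0"
proof -
  obtain B where B: "B \<subseteq> W" "independent B" "W \<subseteq> span B" "card B = dim W"
    using basis_exists by blast
  obtain S where S: "B \<subseteq> S" "S \<subseteq> B \<union> Basis" "independent S" "B \<union> Basis \<subseteq> span S"
    using maximal_independent_subset_extend[of B "B \<union> Basis"] B by blast
  have "span S = UNIV" using S(4) by (metis Un_subset_iff span_Basis span_mono span_span top.extremum_uniqueI)
  then have cS: "card S = CARD('n)"
    using dim_eq_card_independent[OF S(3)] by (metis dim_span dim_UNIV DIM_cart DIM_real mult.right_neutral)
  define J where "J = {j. axis j (1::real) \<in> S - B}"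
  have SB: "S - B = (\<lambda>j. axis j 1) ` J"
  proof
    show "S - B \<subseteq> (\<lambda>j. axis j 1) ` J"
    proof
      fix x assume x: "x \<in> S - B"
      then have "x \<in> Basis" using S(2) by auto
      then obtain j where "x = axis j 1" by (auto simp: Basis_vec_def)
      then show "x \<in> (\<lambda>j. axis j 1) ` J" using x by (auto simp: J_def)
    qed
  qed (auto simp: J_def)
  have "inj_on (\<lambda>j. axis j (1::real)) J" by (auto simp: inj_on_def axis_eq_axis)
  then have cJ: "card J = card (S - B)" unfolding SB by (simp add: card_image)
  have fB: "finite B" "finite S" using independent_imp_finite B S by auto
  show ?thesis
  proof (rule that[of "- J"])
    show "card (- J) = dim W"
      using cJ cS fB S(1) B(4) card_mono[of S B] by (simp add: Compl_eq_Diff_UNIV card_Diff_subset)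
    fix w assume w: "w \<in> W" "\<forall>l\<in>- J. w $ l = 0"
    have "w = (\<Sum>j\<in>UNIV. w $ j *\<^sub>R axis j 1)"
      using basis_expansion[of w] by (simp add: scalar_mult_eq_scaleR)
    also have "\<dots> = (\<Sum>j\<in>J. w $ j *\<^sub>R axis j 1)"
      using w(2) by (intro sum.mono_neutral_right) auto
    also have "\<dots> \<in> span (S - B)"
      unfolding SB by (intro span_sum span_scale span_base) auto
    finally have 1: "w \<in> span (S - B)" .
    have 2: "w \<in> span B" using w(1) B(3) by auto
    \<comment> \<open>The two spans add up to the whole space and their dimensions add up to its
      dimension, so their intersection is trivial.\<close>
    have "dim {x + y |x y. x \<in> span (S - B) \<and> y \<in> span B} + dim (span (S - B) \<inter> span B)
        = dim (span (S - B)) + dim (span B)"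
      by (rule dim_sums_Int) auto
    moreover have "{x + y |x y. x \<in> span (S - B) \<and> y \<in> span B} = UNIV"
      using span_Un[of "S - B" B] S(1) \<open>span S = UNIV\<close> by (simp add: Un_absorb2)
    moreover have "dim (span (S - B)) = card (S - B)" "dim (span B) = card B"
      using dim_eq_card_independent B(2) independent_mono[OF S(3)] by (metis dim_span Diff_subset)+
    moreover have "card (S - B) + card B = CARD('n)"
      using fB S(1) cS card_mono[of S B] by (simp add: card_Diff_subset)
    ultimately have "dim (span (S - B) \<inter> span B) = 0" by simp
    then have "span (S - B) \<inter> span B \<subseteq> {0}" by simp
    then show "w = 0" using 1 2 by auto
  qed
qed

text \<open>On the tangent space at a point some projection to \<open>m\<close> coordinates is
  injective. An open mapping theorem that asks for continuity and a derivative at one point then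
  produces the box.\<close>

lemma Ck_submanifold_projection_box:
  fixes S :: "(real^'n::finite) set"
  assumes S: "Ck_submanifold k m S" and k: "k \<ge> 1" and ne: "S \<noteq> {}"
  obtains I :: "'n set" and c :: "real^'n" and \<rho> :: real where "card I = m" "0 < \<rho>" "\<rho> \<le> 1"
    "\<And>x. (\<And>l. l \<in> I \<Longrightarrow> \<bar>x $ l - c $ l\<bar> \<le> \<rho>) \<Longrightarrow> \<exists>p\<in>S. \<forall>l\<in>I. p $ l = x $ l"
proof -
  obtain p where p: "p \<in> S" using ne by auto
  obtain U V \<phi> L where c: "p \<in> U" "Ck_diffeo_on k U V \<phi>" "subspace L" "dim L = m"
      "\<phi> ` (U \<inter> S) = V \<inter> L"
    using S p unfolding Ck_submanifold_def by blast
  define \<psi> where "\<psi> = inv_into U \<phi>"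
  have C: "open U" "open V" "Ck_on k U \<phi>" "inj_on \<phi> U" "\<phi> ` U = V" "Ck_on k V \<psi>"
    using c by (auto simp: Ck_diffeo_on_def \<psi>_def)
  have Lp: "\<phi> p \<in> V" "\<phi> p \<in> L" using c(1,5) p by auto
  have inv: "\<psi> (\<phi> x) = x" if "x \<in> U" for x using that C by (simp add: \<psi>_def)
  have inv': "\<phi> (\<psi> y) = y" if "y \<in> V" for y using that C by (auto simp: \<psi>_def f_inv_into_f)
  have \<psi>S: "\<psi> y \<in> S" if "y \<in> V" "y \<in> L" for y
  proof -
    have "y \<in> \<phi> ` (U \<inter> S)" using that c(5) by auto
    then show ?thesis using inv by auto
  qed
  obtain j where j: "k = Suc j" using k by (metis Suc_le_D One_nat_def)
  obtain \<phi>' where \<phi>': "(\<phi> has_derivative \<phi>') (at p)"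
    using C(3) c(1) j by (auto simp: differentiable_def)
  obtain \<psi>' where \<psi>': "(\<psi> has_derivative \<psi>') (at (\<phi> p))"
    using C(6) Lp j by (auto simp: differentiable_def)
  have lin: "linear \<psi>'" using \<psi>' has_derivative_linear by blast
  have "((\<lambda>y. \<phi> (\<psi> y)) has_derivative (\<lambda>y. \<phi>' (\<psi>' y))) (at (\<phi> p))"
    using has_derivative_compose[OF \<psi>'] \<phi>' inv[OF c(1)] by simp
  then have "((\<lambda>y. y) has_derivative (\<lambda>y. \<phi>' (\<psi>' y))) (at (\<phi> p))"
    by (rule has_derivative_transform_within_open[OF _ C(2) Lp(1)]) (use inv' in auto)
  then have id: "\<phi>' (\<psi>' y) = y" for y
    using has_derivative_unique[OF _ has_derivative_ident] by (metis (no_types))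
  then have inj: "inj \<psi>'" by (metis injI)
  have "dim (\<psi>' ` L) = m" using dim_image_eq[OF lin] inj c(4) by (metis inj_on_subset subset_UNIV)
  moreover have "subspace (\<psi>' ` L)" using lin c(3) by (rule linear_subspace_image)
  \<comment> \<open>The image of \<open>L\<close> under \<open>\<psi>'\<close> is the tangent space
    of \<open>S\<close> at \<open>p\<close>.\<close>
  ultimately obtain I :: "'n set" where I: "card I = m"
      "\<And>w. w \<in> \<psi>' ` L \<Longrightarrow> (\<forall>l\<in>I. w $ l = 0) \<Longrightarrow> w = 0"
    using coordinate_complement by metis
  define P :: "real^'n \<Rightarrow> real^'n" where "P x = (\<chi> l. if l \<in> I then x $ l else 0)" for x
  have P: "linear P" by (rule linearI) (auto simp: P_def vec_eq_iff)
  have PP: "P (P x) = P x" for x by (simp add: P_def vec_eq_iff)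
  have lf: "linear (\<lambda>y. P (\<psi>' y))" using linear_compose[OF lin P] by (simp add: o_def)
  have injL: "inj_on (\<lambda>y. P (\<psi>' y)) L"
  proof (subst linear_injective_on_subspace_0[OF lf c(3)], intro ballI impI)
    fix y assume y: "y \<in> L" "P (\<psi>' y) = 0"
    then have "\<forall>l\<in>I. \<psi>' y $ l = 0" by (auto simp: P_def vec_eq_iff) metis
    then have "\<psi>' y = 0" using I(2) y by blast
    then show "y = 0" using id[of y] id[of 0] linear_0[OF lin] by metis
  qed
  have sub: "(\<lambda>y. P (\<psi>' y)) ` L = range P"
  proof (rule subspace_dim_equal)
    show "subspace ((\<lambda>y. P (\<psi>' y)) ` L)" using lf c(3) by (rule linear_subspace_image)
    show "subspace (range P)" using P by (rule linear_subspace_image) auto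
    show "(\<lambda>y. P (\<psi>' y)) ` L \<subseteq> range P" by auto
    have "range P \<subseteq> span ((\<lambda>l. axis l 1) ` I)"
    proof
      fix x assume "x \<in> range P"
      then have x0: "x $ l = 0" if "l \<notin> I" for l using that by (auto simp: P_def)
      have "x = (\<Sum>j\<in>UNIV. x $ j *\<^sub>R axis j 1)"
        using basis_expansion[of x] by (simp add: scalar_mult_eq_scaleR)
      also have "\<dots> = (\<Sum>j\<in>I. x $ j *\<^sub>R axis j 1)"
        using x0 by (intro sum.mono_neutral_right) auto
      also have "\<dots> \<in> span ((\<lambda>l. axis l 1) ` I)"
        by (intro span_sum span_scale span_base) auto
      finally show "x \<in> span ((\<lambda>l. axis l 1) ` I)" .
    qed
    then have "dim (range P) \<le> card ((\<lambda>l. axis l (1::real)) ` I)" by (rule dim_le_card) auto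
    also have "\<dots> \<le> m" using card_image_le[of I] I(1) by auto
    also have "m = dim ((\<lambda>y. P (\<psi>' y)) ` L)"
    proof -
      have "span L = L" using c(3) by simp
      then show ?thesis using dim_image_eq[OF lf, of L] injL c(4) by metis
    qed
    finally show "dim (range P) \<le> dim ((\<lambda>y. P (\<psi>' y)) ` L)" .
  qed
  \<comment> \<open>\<open>A\<close> inverts the projected derivative, so that \<open>F\<close>
    below has the identity as its derivative at \<open>0\<close>.\<close>
  obtain A where A: "range A \<subseteq> L" "linear A" "\<forall>v\<in>(\<lambda>y. P (\<psi>' y)) ` L. P (\<psi>' (A v)) = v"
    using linear_exists_right_inverse_on[OF lf c(3)] by blast
  have AP: "P (\<psi>' (A (P y))) = P y" for y using A(3) sub by blast
  define g where "g y = \<phi> p + A (P y)" for y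
  \<comment> \<open>Copying the coordinates outside \<open>I\<close> turns the projected
    parametrisation into a map of the full space to itself, to which the open mapping theorem
    applies.\<close>
  define F where "F y = P (\<psi> (g y)) + (y - P y)" for y
  have g: "(g has_derivative (\<lambda>y. A (P y))) (at y)" for y
    unfolding g_def[abs_def] using linear_compose[OF P A(2)]
    by (intro has_derivative_eq_rhs[OF has_derivative_add[OF has_derivative_const linear_imp_has_derivative]])
       (auto simp: o_def)
  have cg: "continuous_on UNIV g"
    using g by (meson continuous_at_imp_continuous_on has_derivative_continuous)
  have g0: "g 0 = \<phi> p" by (simp add: g_def linear_0[OF P] linear_0[OF A(2)])
  define V' where "V' = g -` V"
  have oV: "open V'" unfolding V'_def using cg C(2) by (simp add: continuous_on_open_vimage)
  have V0: "0 \<in> V'" using Lp by (simp add: V'_def g0)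
  have cF: "continuous_on V' F"
    unfolding F_def[abs_def]
    by (intro continuous_on_add continuous_on_diff continuous_on_id linear_continuous_on
        continuous_on_compose2[OF linear_continuous_on continuous_on_compose2[OF Ck_on_continuous[OF C(6)]
           continuous_on_subset[OF cg]]])
       (auto simp: V'_def linear_conv_bounded_linear[symmetric] P)
  have dP: "(P has_derivative P) F" for F using linear_imp_has_derivative[OF P] .
  have "(F has_derivative (\<lambda>y. P (\<psi>' (A (P y))) + (y - P y))) (at 0)"
    unfolding F_def[abs_def]
    by (intro has_derivative_add has_derivative_diff has_derivative_ident dP
         has_derivative_compose[OF has_derivative_compose[OF g] dP])
       (simp add: g0 \<psi>')
  then have dF: "(F has_derivative (\<lambda>y. y)) (at 0)" by (simp add: AP)
  have "F 0 \<in> interior (F ` V')"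
    by (rule sussmann_open_mapping[OF oV cF V0 dF, of "\<lambda>y. y" V'])
       (use V0 oV in \<open>auto simp: interior_open id_def o_def bounded_linear_ident\<close>)
  then obtain e where e: "e > 0" "ball (F 0) e \<subseteq> F ` V'" by (metis mem_interior)
  \<comment> \<open>The factor \<open>2 * real CARD('n)\<close> pays for bounding the norm by the
    sum of the coordinates. The cap \<open>1\<close> later keeps the arguments of the sine in
    \<open>[0, 1]\<close>.\<close>
  define \<rho> where "\<rho> = min 1 (e / (2 * real CARD('n)))"
  show ?thesis
  proof (rule that[of I \<rho> "F 0"])
    show "card I = m" by fact
    show "0 < \<rho>" "\<rho> \<le> 1" using e by (auto simp: \<rho>_def)
    fix x assume x: "\<And>l. l \<in> I \<Longrightarrow> \<bar>x $ l - F 0 $ l\<bar> \<le> \<rho>"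
    \<comment> \<open>\<open>z\<close> agrees with \<open>x\<close> on \<open>I\<close> and with
      \<open>F 0\<close> elsewhere, hence is close to \<open>F 0\<close>.\<close>
    define z where "z = P x + (F 0 - P (F 0))"
    have "norm (z - F 0) \<le> (\<Sum>l\<in>UNIV. \<bar>(z - F 0) $ l\<bar>)" by (rule norm_le_l1_cart)
    also have "\<dots> \<le> (\<Sum>l\<in>(UNIV::'n set). \<rho>)"
      using x \<open>0 < \<rho>\<close> by (intro sum_mono) (auto simp: z_def P_def)
    also have "\<dots> \<le> real CARD('n) * (e / (2 * real CARD('n)))"
    proof -
      have "\<rho> \<le> e / (2 * real CARD('n))" by (simp add: \<rho>_def)
      then show ?thesis by (simp only: sum_constant) (rule mult_left_mono, auto)
    qed
    also have "\<dots> < e" using e by simp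
    finally have "z \<in> ball (F 0) e" by (simp add: dist_norm norm_minus_commute)
    then obtain y where y: "y \<in> V'" "z = F y" using e by auto
    have "P z = P (\<psi> (g y))" unfolding y(2) F_def
      by (simp add: linear_add[OF P] linear_diff[OF P] PP)
    moreover have "P z = P x" unfolding z_def
      by (simp add: linear_add[OF P] linear_diff[OF P] PP)
    ultimately have "P (\<psi> (g y)) = P x" by simp
    then have "\<forall>l\<in>I. \<psi> (g y) $ l = x $ l" by (auto simp: P_def vec_eq_iff) metis
    moreover have "\<psi> (g y) \<in> S"
    proof (rule \<psi>S)
      show "g y \<in> V" using y by (simp add: V'_def)
      show "g y \<in> L" using A(1) Lp(2) c(3) by (auto simp: g_def intro: subspace_add)
    qed
    ultimately show "\<exists>p\<in>S. \<forall>l\<in>I. p $ l = x $ l" by blast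
  qed
qed

subsection \<open>Averaging over shears\<close>

text \<open>The condition says that \<open>L\<close> divides
  \<open>\<lfloor>x * L\<rfloor> + int t\<close>, and exactly one of \<open>L\<close> consecutive
  integers is divisible by \<open>L\<close>.\<close>

lemma unique_residue_shift:
  fixes x :: real
  assumes "L > 0"
  shows "\<exists>!t. t < L \<and> frac (x + real t / real L) < 1 / real L"
proof -
  have key: "frac (x + real t / real L) < 1 / real L \<longleftrightarrow> int L dvd \<lfloor>x * L\<rfloor> + int t" for t
  proof -
    define X where "X = x + real t / real L"
    have fl: "\<lfloor>X * L\<rfloor> = \<lfloor>x * L\<rfloor> + int t" using assms by (simp add: X_def algebra_simps)
    have LL: "real L > 0" using assms by simp
    have "frac X < 1 / real L \<longleftrightarrow> \<lfloor>X * L\<rfloor> = \<lfloor>X\<rfloor> * int L"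
    proof -
      have "frac X < 1 / real L \<longleftrightarrow> X * L < of_int \<lfloor>X\<rfloor> * L + 1"
        using LL by (simp add: frac_def field_simps)
      moreover have "of_int \<lfloor>X\<rfloor> * real L \<le> X * L" using LL by (simp add: mult_right_mono)
      ultimately show ?thesis by (simp add: floor_eq_iff)
    qed
    also have "\<dots> \<longleftrightarrow> int L dvd \<lfloor>X * L\<rfloor>"
    proof
      assume "int L dvd \<lfloor>X * L\<rfloor>"
      then obtain i where i: "\<lfloor>X * L\<rfloor> = int L * i" by (elim dvdE)
      have "of_int (int L * i) \<le> X * L" "X * L < of_int (int L * i) + 1"
        using floor_correct[of "X * L"] i by auto
      then have "of_int i * real L \<le> X * L" "X * L < (of_int i + 1) * L"
        using assms by (auto simp: algebra_simps)
      then have "of_int i \<le> X" "X < of_int i + 1" using LL by auto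
      then have "\<lfloor>X\<rfloor> = i" by linarith
      then show "\<lfloor>X * L\<rfloor> = \<lfloor>X\<rfloor> * int L" using i by simp
    qed auto
    finally show ?thesis unfolding fl by (simp add: X_def)
  qed
  let ?t = "nat ((- \<lfloor>x * L\<rfloor>) mod int L)"
  show ?thesis unfolding key
  proof (rule ex1I[of _ ?t])
    show "?t < L \<and> int L dvd \<lfloor>x * L\<rfloor> + int ?t"
      using assms by (simp add: nat_less_iff mod_eq_0_iff_dvd[symmetric] mod_add_right_eq)
    fix t assume t: "t < L \<and> int L dvd \<lfloor>x * L\<rfloor> + int t"
    then have "int L dvd - (\<lfloor>x * L\<rfloor> + int t)" by (simp only: dvd_minus_iff)
    then have "(- \<lfloor>x * L\<rfloor>) mod int L = int t mod int L"
      by (simp add: mod_eq_dvd_iff)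
    then show "t = ?t" using t by simp
  qed
qed

lemma card_nat_open_interval:
  fixes a e :: real
  assumes "e > 0"
  shows "finite {c::nat. \<bar>real c - a\<bar> < e}" "real (card {c::nat. \<bar>real c - a\<bar> < e}) \<le> 2 * e + 1"
proof -
  have sub: "int ` {c::nat. \<bar>real c - a\<bar> < e} \<subseteq> {\<lfloor>a - e\<rfloor> + 1 .. \<lceil>a + e\<rceil> - 1}"
    by (auto simp: abs_less_iff) linarith+
  show "finite {c::nat. \<bar>real c - a\<bar> < e}"
    using finite_subset[OF sub] by (simp add: finite_image_iff)
  have "card {c::nat. \<bar>real c - a\<bar> < e} \<le> card {\<lfloor>a - e\<rfloor> + 1 .. \<lceil>a + e\<rceil> - 1}"
    using card_mono[OF _ sub] by (simp add: card_image)
  also have "\<dots> = nat (\<lceil>a + e\<rceil> - 1 - \<lfloor>a - e\<rfloor>)" by simp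
  finally have "real (card {c::nat. \<bar>real c - a\<bar> < e}) \<le> real (nat (\<lceil>a + e\<rceil> - 1 - \<lfloor>a - e\<rfloor>))" by linarith
  also have "\<dots> \<le> 2 * e + 1" using assms by linarith
  finally show "real (card {c::nat. \<bar>real c - a\<bar> < e}) \<le> 2 * e + 1" .
qed

text \<open>The progression stays in an interval of length \<open>\<bar>s\<bar>\<close>, so at most
  \<open>\<bar>s\<bar> + 3\<close> integers matter, and each is approached by at most
  \<open>2 * P / (L * \<bar>s\<bar>) + 1\<close> values of \<open>c\<close>. Multiplying out,
  \<open>\<bar>s\<bar> \<ge> 1\<close> controls the three extra integers and the size of
  \<open>P\<close> absorbs the \<open>+ 1\<close>.\<close>

lemma card_near_integer_progression:
  fixes \<beta> s :: real
  assumes s: "\<bar>s\<bar> \<ge> 1" and L: "L > 0" and P: "real P \<ge> real L * (\<bar>s\<bar> + 3)"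
  shows "real (card {c. c < P \<and> (\<exists>i::int. \<bar>\<beta> + real c / real P * s - of_int i\<bar> < 1 / real L)}) \<le> 9 * real P / real L"
proof -
  have pos0: "\<bar>s\<bar> > 0" "real L \<ge> 1" "real L > 0" using s L by auto
  then have "real L * (\<bar>s\<bar> + 3) > 0" by (intro mult_pos_pos) auto
  then have "real P > 0" using P by linarith
  note pos = this pos0
  define lo where "lo = min \<beta> (\<beta> + s) - 1 / L"
  define hi where "hi = max \<beta> (\<beta> + s) + 1 / L"
  define K where "K = {\<lfloor>lo\<rfloor> + 1 .. \<lceil>hi\<rceil> - 1}"
  define E where "E i = {c::nat. \<bar>real c - (of_int i - \<beta>) * P / s\<bar> < P / (L * \<bar>s\<bar>)}" for i :: int
  let ?S = "{c. c < P \<and> (\<exists>i::int. \<bar>\<beta> + real c / real P * s - of_int i\<bar> < 1 / real L)}"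
  have e: "P / (L * \<bar>s\<bar>) > 0" using pos by simp
  have sub: "?S \<subseteq> (\<Union>i\<in>K. E i)"
  proof safe
    fix c i assume c: "c < P" "\<bar>\<beta> + real c / real P * s - of_int i\<bar> < 1 / real L"
    have q: "0 \<le> real c / P" "real c / P \<le> 1" using c pos by auto
    have "min \<beta> (\<beta> + s) \<le> \<beta> + real c / P * s \<and> \<beta> + real c / P * s \<le> max \<beta> (\<beta> + s)"
    proof (cases "s \<ge> 0")
      case True
      then show ?thesis using mult_right_mono[OF q(2) True] mult_nonneg_nonneg[OF q(1) True] by simp
    next
      case False
      then show ?thesis using mult_right_mono_neg[OF q(2), of s] mult_nonneg_nonpos[OF q(1), of s] by simp
    qed
    then have "lo < of_int i" "of_int i < hi" using c(2) by (simp_all add: lo_def hi_def abs_less_iff)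
    then have iK: "i \<in> K" unfolding K_def by (auto simp: less_ceiling_iff floor_less_iff) linarith+
    have "real c - (of_int i - \<beta>) * P / s = (\<beta> + real c / P * s - of_int i) * (P / s)"
      using pos by (auto simp: field_simps)
    then have "\<bar>real c - (of_int i - \<beta>) * P / s\<bar> = \<bar>\<beta> + real c / P * s - of_int i\<bar> * (P / \<bar>s\<bar>)"
      by (simp add: abs_mult)
    also have "\<dots> < 1 / L * (P / \<bar>s\<bar>)" by (rule mult_strict_right_mono[OF c(2)]) (use pos in auto)
    finally have "c \<in> E i" by (simp add: E_def)
    then show "c \<in> (\<Union>i\<in>K. E i)" using iK by auto
  qed
  have fin: "finite (\<Union>i\<in>K. E i)" using card_nat_open_interval(1)[OF e] by (auto simp: E_def K_def)
  have "real (card ?S) \<le> real (card (\<Union>i\<in>K. E i))" using card_mono[OF fin sub] by simp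
  also have "\<dots> \<le> (\<Sum>i\<in>K. real (card (E i)))"
    using card_UN_le[of K E] by (simp add: K_def flip: of_nat_sum)
  also have "\<dots> \<le> (\<Sum>i\<in>K. 2 * (P / (L * \<bar>s\<bar>)) + 1)"
    by (rule sum_mono) (use card_nat_open_interval(2)[OF e] in \<open>simp add: E_def\<close>)
  also have "\<dots> = real (card K) * (2 * (P / (L * \<bar>s\<bar>)) + 1)" by simp
  also have "\<dots> \<le> (\<bar>s\<bar> + 3) * (2 * (P / (L * \<bar>s\<bar>)) + 1)"
  proof (rule mult_right_mono)
    have "1 / real L \<le> 1" using pos by simp
    then have "hi - lo \<le> \<bar>s\<bar> + 2" by (simp add: hi_def lo_def)
    then show "real (card K) \<le> \<bar>s\<bar> + 3" using pos by (simp add: K_def) linarith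
  qed (use e in simp)
  also have "\<dots> = 2 * (P / L) + 6 * (P / L) / \<bar>s\<bar> + (\<bar>s\<bar> + 3)" using pos by (simp add: field_simps)
  also have "\<dots> \<le> 2 * (P / L) + 6 * (P / L) + P / L"
  proof -
    have "6 * (P / L) / \<bar>s\<bar> \<le> 6 * (P / L) / 1" by (rule divide_left_mono) (use s pos in auto)
    moreover have "\<bar>s\<bar> + 3 \<le> P / L" using P pos by (simp add: field_simps)
    ultimately show ?thesis by linarith
  qed
  finally show ?thesis by simp
qed

text \<open>Fubini for counting: all coordinates but \<open>l\<close> are fixed, and each such slice
  contains at most \<open>B\<close> points.\<close>

lemma card_PiE_slices:
  assumes "finite I" "l \<in> I" and B: "\<And>g. real (card {c. c < P \<and> Q (g(l := c))}) \<le> B"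
  shows "real (card {a \<in> I \<rightarrow>\<^sub>E {..<P}. Q a}) \<le> real P ^ (card I - 1) * B"
proof -
  let ?G = "(I - {l}) \<rightarrow>\<^sub>E {..<P}"
  have fin: "finite ?G" using assms(1) by (auto intro: finite_PiE)
  have eq: "(I \<rightarrow>\<^sub>E {..<P}) = (\<lambda>(y, g). g(l := y)) ` ({..<P} \<times> ?G)"
    using PiE_insert_eq[of l "I - {l}" "\<lambda>_. {..<P}"] assms(2) by (simp add: insert_absorb)
  have sub: "{a \<in> I \<rightarrow>\<^sub>E {..<P}. Q a} \<subseteq> (\<lambda>(g, y). g(l := y)) ` (SIGMA g:?G. {c. c < P \<and> Q (g(l := c))})"
    unfolding eq by force
  have "card {a \<in> I \<rightarrow>\<^sub>E {..<P}. Q a} \<le> card (SIGMA g:?G. {c. c < P \<and> Q (g(l := c))})"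
    by (rule surj_card_le[OF _ sub]) (use fin in auto)
  also have "\<dots> = (\<Sum>g\<in>?G. card {c. c < P \<and> Q (g(l := c))})"
    by (rule card_SigmaI) (use fin in auto)
  finally have "real (card {a \<in> I \<rightarrow>\<^sub>E {..<P}. Q a}) \<le> (\<Sum>g\<in>?G. real (card {c. c < P \<and> Q (g(l := c))}))"
    by (simp flip: of_nat_sum)
  also have "\<dots> \<le> (\<Sum>g\<in>?G. B)" by (rule sum_mono) (rule B)
  also have "\<dots> = real P ^ (card I - 1) * B" using assms(1,2) by (simp add: card_PiE)
  finally show ?thesis .
qed

text \<open>Each \<open>a\<close> admits exactly one shift. Among the \<open>P ^ card I * L\<close>
  parameters the event thus has probability exactly \<open>1 / L\<close>, whatever \<open>X\<close>
  is.\<close>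

lemma card_good_shifts:
  assumes "finite I" "L > 0"
  shows "card {\<theta> \<in> (I \<rightarrow>\<^sub>E {..<P}) \<times> {..<L}. frac (X (fst \<theta>) + real (snd \<theta>) / real L) < 1 / real L} = P ^ card I"
proof -
  have "{\<theta> \<in> (I \<rightarrow>\<^sub>E {..<P}) \<times> {..<L}. frac (X (fst \<theta>) + real (snd \<theta>) / real L) < 1 / real L}
      = (SIGMA a:I \<rightarrow>\<^sub>E {..<P}. {t. t < L \<and> frac (X a + real t / real L) < 1 / real L})"
    by auto
  moreover have "card {t. t < L \<and> frac (X a + real t / real L) < 1 / real L} = 1" for a
    using unique_residue_shift[OF assms(2), of "X a"] by (simp add: card_1_singleton_iff set_eq_iff) metis
  ultimately show ?thesis using assms(1) by (simp add: card_PiE finite_PiE)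
qed

text \<open>If both conditions hold, the common shift cancels and \<open>X a - X' a\<close> is
  within \<open>1 / L\<close> of an integer; moreover the shift is determined by \<open>a\<close>.
  Varying \<open>a l\<close> alone moves this difference in an arithmetic progression. The resulting
  probability is at most \<open>9 / L^2\<close>, so up to a constant the two events are
  independent.\<close>

lemma card_good_shift_pairs:
  fixes x x' :: real and s s' :: "'i \<Rightarrow> real"
  assumes I: "finite I" "l \<in> I" and L: "L > 0" and sl: "\<bar>s l - s' l\<bar> \<ge> 1"
    and P: "real P \<ge> real L * (\<bar>s l - s' l\<bar> + 3)"
  defines "X \<equiv> \<lambda>a. x + (\<Sum>l\<in>I. real (a l) / real P * s l)"
    and "X' \<equiv> \<lambda>a. x' + (\<Sum>l\<in>I. real (a l) / real P * s' l)"
  shows "real (card {\<theta> \<in> (I \<rightarrow>\<^sub>E {..<P}) \<times> {..<L}. frac (X (fst \<theta>) + real (snd \<theta>) / real L) < 1 / real L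
      \<and> frac (X' (fst \<theta>) + real (snd \<theta>) / real L) < 1 / real L}) \<le> 9 * real P ^ card I / real L"
proof -
  define Q where "Q a = (\<exists>i::int. \<bar>X a - X' a - of_int i\<bar> < 1 / real L)" for a
  let ?S = "{\<theta> \<in> (I \<rightarrow>\<^sub>E {..<P}) \<times> {..<L}. frac (X (fst \<theta>) + real (snd \<theta>) / real L) < 1 / real L
      \<and> frac (X' (fst \<theta>) + real (snd \<theta>) / real L) < 1 / real L}"
  let ?T = "{a \<in> I \<rightarrow>\<^sub>E {..<P}. Q a}"
  have finT: "finite ?T" using I by (simp add: finite_PiE)
  have "inj_on fst ?S"
  proof (rule inj_onI, clarsimp)
    fix a t t' assume "t < L" "t' < L" "frac (X a + real t / real L) < 1 / real L"
      "frac (X a + real t' / real L) < 1 / real L"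
    then show "t = t'" using unique_residue_shift[OF L, of "X a"] by blast
  qed
  moreover have "fst ` ?S \<subseteq> ?T"
  proof (clarsimp)
    fix a t assume g: "frac (X a + real t / real L) < 1 / real L" "frac (X' a + real t / real L) < 1 / real L"
    let ?u = "X a + real t / real L" and ?v = "X' a + real t / real L"
    have "X a - X' a - of_int (\<lfloor>?u\<rfloor> - \<lfloor>?v\<rfloor>) = frac ?u - frac ?v" by (simp add: frac_def)
    moreover have "\<bar>frac ?u - frac ?v\<bar> < 1 / real L"
      using g frac_ge_0[of ?u] frac_ge_0[of ?v] by linarith
    ultimately show "Q a" unfolding Q_def by metis
  qed
  ultimately have "card ?S \<le> card ?T" using finT by (rule card_inj_on_le)
  moreover have "real (card ?T) \<le> real P ^ (card I - 1) * (9 * real P / real L)"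
  proof (rule card_PiE_slices[OF I])
    fix g :: "'i \<Rightarrow> nat"
    define \<beta> where "\<beta> = x - x' + (\<Sum>l'\<in>I - {l}. real (g l') / real P * (s l' - s' l'))"
    have "X (g(l := c)) - X' (g(l := c)) = \<beta> + real c / real P * (s l - s' l)" for c
    proof -
      have "X (g(l := c)) - X' (g(l := c)) = x - x' + (\<Sum>l'\<in>I. real ((g(l := c)) l') / real P * (s l' - s' l'))"
        by (simp add: X_def X'_def sum_subtractf right_diff_distrib del: fun_upd_apply)
      also have "(\<Sum>l'\<in>I. real ((g(l := c)) l') / real P * (s l' - s' l')) = real c / real P * (s l - s' l)
          + (\<Sum>l'\<in>I - {l}. real ((g(l := c)) l') / real P * (s l' - s' l'))"
        using I by (subst sum.remove[of I l]) auto
      also have "(\<Sum>l'\<in>I - {l}. real ((g(l := c)) l') / real P * (s l' - s' l'))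
          = (\<Sum>l'\<in>I - {l}. real (g l') / real P * (s l' - s' l'))" by (rule sum.cong) auto
      finally show ?thesis unfolding \<beta>_def by linarith
    qed
    then show "real (card {c. c < P \<and> Q (g(l := c))}) \<le> 9 * real P / real L"
      using card_near_integer_progression[OF sl L P, of \<beta>] by (simp add: Q_def)
  qed
  moreover have "real P ^ (card I - 1) * (9 * real P / real L) = 9 * real P ^ card I / real L"
  proof -
    have "card I = Suc (card I - 1)" using I by (metis card_gt_0_iff Suc_pred' empty_iff)
    then have "real P ^ card I = real P * real P ^ (card I - 1)" by (metis power_Suc)
    then show ?thesis by simp
  qed
  ultimately show ?thesis by linarith
qed

text \<open>Sum \<open>1 \<ge> 2 g - g\<^sup>2\<close> over the union, \<open>g\<close> being the number of sets containing a point.\<close>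

lemma card_UN_second_moment:
  assumes Y: "finite Y" and A: "\<And>y. y \<in> Y \<Longrightarrow> finite (A y)"
  shows "2 * (\<Sum>y\<in>Y. real (card (A y))) - (\<Sum>y\<in>Y. \<Sum>y'\<in>Y. real (card (A y \<inter> A y'))) \<le> real (card (\<Union>y\<in>Y. A y))"
proof -
  let ?U = "\<Union>y\<in>Y. A y"
  have fU: "finite ?U" using assms by auto
  have c: "(\<Sum>x\<in>?U. of_bool (x \<in> B)) = real (card B)" if "B \<subseteq> ?U" for B
    using that fU by (simp add: of_bool_def sum.If_cases Int_absorb1)
  define g where "g x = (\<Sum>y\<in>Y. of_bool (x \<in> A y) :: real)" for x
  have 1: "(\<Sum>x\<in>?U. g x) = (\<Sum>y\<in>Y. real (card (A y)))"
    unfolding g_def by (subst sum.swap, rule sum.cong) (auto intro!: c)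
  have "(\<Sum>x\<in>?U. g x * g x) = (\<Sum>x\<in>?U. \<Sum>y\<in>Y. \<Sum>y'\<in>Y. of_bool (x \<in> A y \<inter> A y'))"
    unfolding g_def sum_product by (intro sum.cong refl) auto
  also have "\<dots> = (\<Sum>y\<in>Y. \<Sum>x\<in>?U. \<Sum>y'\<in>Y. of_bool (x \<in> A y \<inter> A y'))" by (rule sum.swap)
  also have "\<dots> = (\<Sum>y\<in>Y. \<Sum>y'\<in>Y. \<Sum>x\<in>?U. of_bool (x \<in> A y \<inter> A y'))"
    by (intro sum.cong refl sum.swap)
  also have "\<dots> = (\<Sum>y\<in>Y. \<Sum>y'\<in>Y. real (card (A y \<inter> A y')))"
    by (intro sum.cong refl c) auto
  finally have 2: "(\<Sum>x\<in>?U. g x * g x) = (\<Sum>y\<in>Y. \<Sum>y'\<in>Y. real (card (A y \<inter> A y')))" .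
  have "0 \<le> (\<Sum>x\<in>?U. (1 - g x) * (1 - g x))" by (intro sum_nonneg) simp
  also have "\<dots> = (\<Sum>x\<in>?U. 1 - 2 * g x + g x * g x)" by (rule sum.cong) (auto simp: algebra_simps)
  also have "\<dots> = real (card ?U) - 2 * (\<Sum>x\<in>?U. g x) + (\<Sum>x\<in>?U. g x * g x)"
    by (simp add: sum.distrib sum_subtractf sum_distrib_left)
  finally show ?thesis unfolding 1 2 by linarith
qed

text \<open>The coordinates \<open>j\<close> receive independent parameters, so with
  \<open>d = card J\<close> a candidate is good with probability \<open>1 / L^d\<close> and two
  candidates of a cell are both good with probability at most \<open>9^d / L^(2 d)\<close>. By
  \<open>LY\<close> the pairs of distinct candidates cost at most half of the first moment. A cell
  therefore has a good candidate with probability at least \<open>card Y / (2 * L^d)\<close>, and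
  some parameter does as well as the average.\<close>

lemma exists_shear_with_many_good_cells:
  fixes F :: "'z \<Rightarrow> 'y \<Rightarrow> 'j \<Rightarrow> real" and s :: "'z \<Rightarrow> 'y \<Rightarrow> 'i \<Rightarrow> real"
  assumes fin: "finite Z" "finite Y" "finite I" "finite J" and L: "L > 0"
    and sep: "\<And>z y y'. z \<in> Z \<Longrightarrow> y \<in> Y \<Longrightarrow> y' \<in> Y \<Longrightarrow> y \<noteq> y' \<Longrightarrow> \<exists>l\<in>I. \<bar>s z y l - s z y' l\<bar> \<ge> 1"
    and LY: "2 * 9 ^ card J * real (card Y) \<le> real L ^ card J"
  obtains \<tau> :: "'j \<Rightarrow> real" and a :: "'j \<Rightarrow> 'i \<Rightarrow> real" where
    "\<And>j. j \<in> J \<Longrightarrow> 0 \<le> \<tau> j \<and> \<tau> j \<le> 1" "\<And>j l. j \<in> J \<Longrightarrow> l \<in> I \<Longrightarrow> 0 \<le> a j l \<and> a j l \<le> 1"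
    "real (card Z) * real (card Y) / (2 * real L ^ card J)
      \<le> real (card {z \<in> Z. \<exists>y\<in>Y. \<forall>j\<in>J. frac (F z y j + \<tau> j + (\<Sum>l\<in>I. a j l * s z y l)) < 1 / real L})"
proof -
  let ?d = "card J"
  have "bdd_above ((\<lambda>(z, y, y', l). real L * (\<bar>s z y l - s z y' l\<bar> + 3)) ` (Z \<times> Y \<times> Y \<times> I))"
    using fin by (intro bdd_above_finite) auto
  then obtain B where "\<forall>x\<in>(\<lambda>(z, y, y', l). real L * (\<bar>s z y l - s z y' l\<bar> + 3)) ` (Z \<times> Y \<times> Y \<times> I). x \<le> B"
    unfolding bdd_above_def by blast
  then have B: "real L * (\<bar>s z y l - s z y' l\<bar> + 3) \<le> B"
    if "z \<in> Z" "y \<in> Y" "y' \<in> Y" "l \<in> I" for z y y' l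
    using that by simp
  \<comment> \<open>\<open>P\<close> is the fineness of the random slopes. One value serves all
    pairs of candidates, since there are finitely many.\<close>
  obtain P where P: "real P \<ge> max 1 B" using real_arch_simple by blast
  have P0: "P > 0" using P by auto
  \<comment> \<open>An element of \<open>\<Theta>1\<close> consists of the slopes and the shift for
    one coordinate \<open>j\<close>; \<open>\<Theta>\<close> is the whole sample space.\<close>
  define \<Theta>1 where "\<Theta>1 = (I \<rightarrow>\<^sub>E {..<P}) \<times> {..<L}"
  define \<Theta> where "\<Theta> = (J \<rightarrow>\<^sub>E \<Theta>1)"
  define X where "X z y j a = F z y j + (\<Sum>l\<in>I. real (a l) / real P * s z y l)" for z y j and a :: "'i \<Rightarrow> nat"
  define G where "G z y j = {\<theta> \<in> \<Theta>1. frac (X z y j (fst \<theta>) + real (snd \<theta>) / real L) < 1 / real L}" for z y j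
  define A where "A z y = (\<Pi>\<^sub>E j\<in>J. G z y j)" for z y
  define q where "q = (real P ^ card I) ^ ?d"
  have q0: "q > 0" using P0 by (simp add: q_def)
  have L0: "real L ^ ?d > 0" using L by simp
  have fT1: "finite \<Theta>1" using fin by (simp add: \<Theta>1_def finite_PiE)
  have fT: "finite \<Theta>" using fin fT1 by (simp add: \<Theta>_def finite_PiE)
  have GT: "G z y j \<subseteq> \<Theta>1" for z y j by (auto simp: G_def)
  have AT: "A z y \<subseteq> \<Theta>" for z y unfolding A_def \<Theta>_def using GT by (intro PiE_mono) auto
  have cT: "real (card \<Theta>) = q * real L ^ ?d"
    using fin by (simp add: \<Theta>_def \<Theta>1_def q_def card_PiE card_cartesian_product power_mult_distrib)
  have cA: "real (card (A z y)) = q" for z y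
  proof -
    have "card (G z y j) = P ^ card I" for j
      unfolding G_def \<Theta>1_def by (rule card_good_shifts[OF fin(3) L])
    then show ?thesis using fin by (simp add: A_def card_PiE q_def)
  qed
  have cAA: "real (card (A z y \<inter> A z y')) \<le> 9 ^ ?d * q / real L ^ ?d"
    if h: "z \<in> Z" "y \<in> Y" "y' \<in> Y" "y \<noteq> y'" for z y y'
  proof -
    obtain l where l: "l \<in> I" "\<bar>s z y l - s z y' l\<bar> \<ge> 1" using sep[OF h] by blast
    have Pl: "real P \<ge> real L * (\<bar>s z y l - s z y' l\<bar> + 3)" using B[OF h(1-3) l(1)] P by simp
    have "A z y \<inter> A z y' = (\<Pi>\<^sub>E j\<in>J. G z y j \<inter> G z y' j)" by (simp add: A_def PiE_Int)
    then have "real (card (A z y \<inter> A z y')) = (\<Prod>j\<in>J. real (card (G z y j \<inter> G z y' j)))"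
      using fin by (simp add: card_PiE)
    also have "\<dots> \<le> (\<Prod>j\<in>J. 9 * real P ^ card I / real L)"
    proof (rule prod_mono, rule conjI)
      fix j assume "j \<in> J"
      have "G z y j \<inter> G z y' j = {\<theta> \<in> (I \<rightarrow>\<^sub>E {..<P}) \<times> {..<L}. frac (X z y j (fst \<theta>) + real (snd \<theta>) / real L) < 1 / real L
         \<and> frac (X z y' j (fst \<theta>) + real (snd \<theta>) / real L) < 1 / real L}"
        by (auto simp: G_def \<Theta>1_def)
      then show "real (card (G z y j \<inter> G z y' j)) \<le> 9 * real P ^ card I / real L"
        using card_good_shift_pairs[of I l L "s z y" "s z y'" P "F z y j" "F z y' j", OF fin(3) l(1) L l(2) Pl]
        by (simp only: X_def)
    qed simp
    also have "\<dots> = 9 ^ ?d * q / real L ^ ?d" by (simp add: q_def power_divide power_mult_distrib)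
    finally show ?thesis .
  qed
  have cell: "real (card Y) * q / 2 \<le> real (card (\<Union>y\<in>Y. A z y))" if z: "z \<in> Z" for z
  proof -
    let ?N = "real (card Y)"
    have "(\<Sum>y\<in>Y. \<Sum>y'\<in>Y. real (card (A z y \<inter> A z y'))) \<le> (\<Sum>y\<in>Y. q + ?N * (9 ^ ?d * q / real L ^ ?d))"
    proof (rule sum_mono)
      fix y assume y: "y \<in> Y"
      have "(\<Sum>y'\<in>Y. real (card (A z y \<inter> A z y'))) = q + (\<Sum>y'\<in>Y - {y}. real (card (A z y \<inter> A z y')))"
        using y fin by (subst sum.remove[of Y y]) (auto simp: cA)
      also have "(\<Sum>y'\<in>Y - {y}. real (card (A z y \<inter> A z y'))) \<le> (\<Sum>y'\<in>Y - {y}. 9 ^ ?d * q / real L ^ ?d)"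
        by (rule sum_mono) (use cAA z y in auto)
      also have "\<dots> = real (card (Y - {y})) * (9 ^ ?d * q / real L ^ ?d)" by simp
      also have "\<dots> \<le> ?N * (9 ^ ?d * q / real L ^ ?d)"
        using fin q0 L0 by (intro mult_right_mono) (auto simp: card_Diff1_le)
      finally show "(\<Sum>y'\<in>Y. real (card (A z y \<inter> A z y'))) \<le> q + ?N * (9 ^ ?d * q / real L ^ ?d)" by simp
    qed
    also have "\<dots> = ?N * (q + ?N * (9 ^ ?d * q / real L ^ ?d))" by simp
    also have "\<dots> \<le> ?N * (q + q / 2)"
    proof (intro mult_left_mono add_left_mono)
      have "?N * 9 ^ ?d * q \<le> real L ^ ?d / 2 * q" using LY q0 by (intro mult_right_mono) (auto simp: mult_ac)
      then show "?N * (9 ^ ?d * q / real L ^ ?d) \<le> q / 2" using L0 by (simp add: field_simps)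
    qed simp
    finally have "(\<Sum>y\<in>Y. \<Sum>y'\<in>Y. real (card (A z y \<inter> A z y'))) \<le> ?N * (q + q / 2)" .
    moreover have "2 * (\<Sum>y\<in>Y. real (card (A z y))) - (\<Sum>y\<in>Y. \<Sum>y'\<in>Y. real (card (A z y \<inter> A z y')))
        \<le> real (card (\<Union>y\<in>Y. A z y))"
      using fin fT AT by (intro card_UN_second_moment) (auto intro: finite_subset)
    ultimately show ?thesis by (simp add: cA algebra_simps)
  qed
  let ?H = "\<lambda>\<theta>. {z \<in> Z. \<exists>y\<in>Y. \<theta> \<in> A z y}"
  let ?m = "real (card Z) * real (card Y) / (2 * real L ^ ?d)"
  \<comment> \<open>Otherwise, counting the pairs of a parameter and a cell with a good candidate in
    both orders contradicts \<open>cell\<close>.\<close>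
  have "\<exists>\<theta>\<in>\<Theta>. ?m \<le> real (card (?H \<theta>))"
  proof (rule ccontr)
    assume "\<not> ?thesis"
    then have lt: "real (card (?H \<theta>)) < ?m" if "\<theta> \<in> \<Theta>" for \<theta> using that by force
    have ne: "\<Theta> \<noteq> {}" using cT q0 L0 by (metis card.empty less_irrefl mult_pos_pos of_nat_0)
    have "(\<Sum>\<theta>\<in>\<Theta>. real (card (?H \<theta>))) < (\<Sum>\<theta>\<in>\<Theta>. ?m)" by (rule sum_strict_mono[OF fT ne lt])
    also have "\<dots> = real (card Z) * (real (card Y) * q / 2)" using L by (simp add: cT)
    also have "\<dots> \<le> (\<Sum>z\<in>Z. real (card (\<Union>y\<in>Y. A z y)))" using sum_mono[OF cell] by simp
    also have "\<dots> = (\<Sum>z\<in>Z. \<Sum>\<theta>\<in>\<Theta>. of_bool (\<exists>y\<in>Y. \<theta> \<in> A z y))"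
    proof (rule sum.cong[OF refl])
      fix z
      have "{\<theta> \<in> \<Theta>. \<exists>y\<in>Y. \<theta> \<in> A z y} = (\<Union>y\<in>Y. A z y)" using AT by auto
      then show "real (card (\<Union>y\<in>Y. A z y)) = (\<Sum>\<theta>\<in>\<Theta>. of_bool (\<exists>y\<in>Y. \<theta> \<in> A z y))"
        using fT by (simp add: of_bool_def sum.If_cases Collect_conj_eq[symmetric] Int_def)
    qed
    also have "\<dots> = (\<Sum>\<theta>\<in>\<Theta>. \<Sum>z\<in>Z. of_bool (\<exists>y\<in>Y. \<theta> \<in> A z y))" by (rule sum.swap)
    also have "\<dots> = (\<Sum>\<theta>\<in>\<Theta>. real (card (?H \<theta>)))"
      using fin by (simp add: of_bool_def sum.If_cases Int_def)
    finally show False by simp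
  qed
  then obtain \<theta> where \<theta>: "\<theta> \<in> \<Theta>" "?m \<le> real (card (?H \<theta>))" by blast
  define \<tau> where "\<tau> j = real (snd (\<theta> j)) / real L" for j
  define a where "a j l = real (fst (\<theta> j) l) / real P" for j l
  have mem: "fst (\<theta> j) \<in> I \<rightarrow>\<^sub>E {..<P}" "snd (\<theta> j) < L" if "j \<in> J" for j
    using PiE_mem[OF \<theta>(1)[unfolded \<Theta>_def] that] by (auto simp: \<Theta>1_def)
  have "?H \<theta> \<subseteq> {z \<in> Z. \<exists>y\<in>Y. \<forall>j\<in>J. frac (F z y j + \<tau> j + (\<Sum>l\<in>I. a j l * s z y l)) < 1 / real L}"
  proof clarsimp
    fix z y assume "z \<in> Z" and y: "y \<in> Y" "\<theta> \<in> A z y"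
    have "frac (F z y j + \<tau> j + (\<Sum>l\<in>I. a j l * s z y l)) < 1 / real L" if "j \<in> J" for j
      using PiE_mem[OF y(2)[unfolded A_def] that] by (simp add: G_def X_def \<tau>_def a_def add_ac)
    then show "\<exists>y\<in>Y. \<forall>j\<in>J. frac (F z y j + \<tau> j + (\<Sum>l\<in>I. a j l * s z y l)) < 1 / real L"
      using y(1) by blast
  qed
  then have "real (card (?H \<theta>)) \<le> real (card {z \<in> Z. \<exists>y\<in>Y. \<forall>j\<in>J. frac (F z y j + \<tau> j + (\<Sum>l\<in>I. a j l * s z y l)) < 1 / real L})"
    using fin by (intro of_nat_mono card_mono) auto
  then show ?thesis
  proof (intro that[of \<tau> a] order_trans[OF \<theta>(2)])
    show "0 \<le> \<tau> j \<and> \<tau> j \<le> 1" if "j \<in> J" for j using mem[OF that] by (simp add: \<tau>_def)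
    show "0 \<le> a j l \<and> a j l \<le> 1" if "j \<in> J" "l \<in> I" for j l
      using PiE_mem[OF mem(1)[OF that(1)] that(2)] by (simp add: a_def)
  qed
qed

subsection \<open>The perturbation\<close>

text \<open>\<open>G\<close> takes the same value at \<open>x\<close>, \<open>x + G x\<close> and
  \<open>x - G x\<close>, so subtracting it undoes the map.\<close>

lemma shear_diffeo:
  assumes "Ck_on k UNIV G" "Ck_on k UNIV (\<lambda>x. - G x)" "\<And>x. G (x + G x) = G x" "\<And>x. G (x - G x) = G x"
  shows "Ck_diffeo_on k UNIV UNIV (\<lambda>x. x + G x)"
proof -
  have 1: "(\<lambda>x. x + G x) (x - G x) = x" "(\<lambda>x. x - G x) (x + G x) = x" for x using assms(3,4) by auto
  have inj: "inj (\<lambda>x. x + G x)" by (rule inj_on_inverseI[where g = "\<lambda>x. x - G x"]) (use 1 in auto)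
  have surj: "surj (\<lambda>x. x + G x)" using 1(1) by (metis surjI)
  have "inv_into UNIV (\<lambda>x. x + G x) = (\<lambda>x. x - G x)"
  proof
    fix x show "inv_into UNIV (\<lambda>x. x + G x) x = x - G x"
      by (rule inv_into_f_eq[OF inj]) (use 1 in auto)
  qed
  moreover have "Ck_on k UNIV (\<lambda>x. x - G x)"
    using Ck_on_add[OF open_UNIV Ck_on_ident assms(2)] by simp
  moreover have "Ck_on k UNIV (\<lambda>x. x + G x)" by (rule Ck_on_add[OF open_UNIV Ck_on_ident assms(1)])
  ultimately show ?thesis using inj surj by (simp add: Ck_diffeo_on_def)
qed

text \<open>An infinite set has \<open>card\<close> equal to \<open>0\<close>, so a lower bound on
  the number of lattice points obtained from an injection requires finiteness.\<close>

lemma finite_bounded_Int_scaled_lattice: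
  fixes S :: "(real^'n::finite) set"
  assumes "bounded S" "R > 0"
  shows "finite (S \<inter> scaled_lattice R)"
proof -
  obtain B where B: "\<And>x. x \<in> S \<Longrightarrow> norm x \<le> B" using assms(1) bounded_iff by metis
  let ?f = "\<lambda>x::real^'n. \<lambda>i. \<lfloor>R * x $ i\<rfloor>"
  have fl: "of_int \<lfloor>R * x $ i\<rfloor> = R * x $ i" if "x \<in> scaled_lattice R" for x :: "real^'n" and i
    using that by (auto simp: scaled_lattice_def)
  have "inj_on ?f (S \<inter> scaled_lattice R)"
  proof (rule inj_onI)
    fix x y assume h: "x \<in> S \<inter> scaled_lattice R" "y \<in> S \<inter> scaled_lattice R" "?f x = ?f y"
    have "R * x $ i = R * y $ i" for i using fl[of x i] fl[of y i] h by (metis Int_iff)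
    then show "x = y" using assms(2) by (simp add: vec_eq_iff)
  qed
  moreover have "?f ` (S \<inter> scaled_lattice R) \<subseteq> (\<Pi>\<^sub>E i\<in>UNIV. {\<lfloor>- R * B\<rfloor>..\<lceil>R * B\<rceil>})"
  proof (clarsimp simp: PiE_UNIV_domain)
    fix x i assume "x \<in> S"
    then have "\<bar>x $ i\<bar> \<le> B" using B component_le_norm_cart order_trans by blast
    then have "x $ i \<le> B" "- B \<le> x $ i" by auto
    then have "R * x $ i \<le> R * B" "R * (- B) \<le> R * x $ i"
      using assms(2) by (intro mult_left_mono; simp)+
    then show "\<lfloor>- (R * B)\<rfloor> \<le> \<lfloor>R * x $ i\<rfloor> \<and> \<lfloor>R * x $ i\<rfloor> \<le> \<lceil>R * B\<rceil>"
      by (auto intro: floor_mono) linarith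
  qed
  ultimately show ?thesis by (rule inj_on_finite) (simp add: finite_PiE)
qed

text \<open>For bumps with disjoint supports: at each point the sum costs no more than one
  bump.\<close>

lemma sum_at_most_one_le:
  fixes h :: "'z \<Rightarrow> real"
  assumes "finite Z" "B \<ge> 0" "\<And>z. z \<in> Z \<Longrightarrow> h z \<le> B"
    and "\<And>z z'. z \<in> Z \<Longrightarrow> z' \<in> Z \<Longrightarrow> h z \<noteq> 0 \<Longrightarrow> h z' \<noteq> 0 \<Longrightarrow> z = z'"
  shows "sum h Z \<le> B"
proof (cases "\<exists>z\<in>Z. h z \<noteq> 0")
  case True
  then obtain z where z: "z \<in> Z" "h z \<noteq> 0" by blast
  have "sum h Z = sum h {z}" using assms(1,4) z by (intro sum.mono_neutral_right) auto
  then show ?thesis using assms(3) z by simp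
qed (use assms(2) in simp)

text \<open>Sines replace linear shears because all their derivatives are bounded on the whole
  space. Centres are \<open>2 * r\<close> apart in some coordinate of \<open>I\<close>, so the
  supports of the bumps are disjoint and one bump alone enters the bound; for the same reason the
  other bumps vanish over a centre.\<close>

lemma shear_perturbation:
  fixes I :: "'n::finite set" and c v0 :: "real^'n" and q v :: "'z \<Rightarrow> real^'n" and va :: "'n \<Rightarrow> real^'n"
    and Z :: "'z set" and r \<eta> M :: real and b :: "nat \<Rightarrow> real \<Rightarrow> real"
  assumes b: "\<And>j t. j < k \<Longrightarrow> (b j has_real_derivative b (Suc j) t) (at t)"
    "continuous_on UNIV (b k)" "b 0 0 = 1" "\<And>j t. \<bar>t\<bar> \<ge> 1 \<Longrightarrow> b j t = 0"
    "\<And>j t. j \<le> k \<Longrightarrow> \<bar>b j t\<bar> \<le> M" "M \<ge> 1"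
    and Z: "finite Z" and r: "0 < r" "r \<le> 1"
    and vI: "\<And>l. l \<in> I \<Longrightarrow> v0 $ l = 0" "\<And>l i. l \<in> I \<Longrightarrow> va i $ l = 0" "\<And>l z. l \<in> I \<Longrightarrow> v z $ l = 0"
    and sep: "\<And>z z'. z \<in> Z \<Longrightarrow> z' \<in> Z \<Longrightarrow> z \<noteq> z' \<Longrightarrow> \<exists>l\<in>I. \<bar>q z $ l - q z' $ l\<bar> \<ge> 2 * r"
    and \<eta>: "\<And>z. z \<in> Z \<Longrightarrow> norm (v z) \<le> \<eta>" "\<eta> \<ge> 0"
  obtains G where "Ck_diffeo_on k UNIV UNIV (\<lambda>x. x + G x)"
    "\<And>is x. length is \<le> k \<Longrightarrow>
       norm (iter_partial is G x) \<le> norm v0 + (\<Sum>l\<in>I. norm (va l)) + M ^ CARD('n) / r ^ k * \<eta>"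
    "\<And>x l. l \<in> I \<Longrightarrow> G x $ l = 0"
    "\<And>z x. z \<in> Z \<Longrightarrow> (\<And>l. l \<in> I \<Longrightarrow> x $ l = q z $ l) \<Longrightarrow>
       G x = v0 + (\<Sum>l\<in>I. sin (q z $ l - c $ l) *\<^sub>R va l) + v z"
proof -
  \<comment> \<open>\<open>e\<close> lists the derivatives of the constant \<open>1\<close>, the
    factor in a coordinate on which a term does not depend.\<close>
  define e :: "nat \<Rightarrow> real \<Rightarrow> real" where "e i t = (if i = 0 then 1 else 0)" for i t
  \<comment> \<open>\<open>Inl None\<close> is the translation, \<open>Inl (Some l0)\<close> the
    sine in coordinate \<open>l0\<close>, \<open>Inr z\<close> the bump at \<open>q z\<close>.
    Adding \<open>i * (pi / 2)\<close> to the argument differentiates the sine \<open>i\<close>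
    times.\<close>
  define u :: "'n option + 'z \<Rightarrow> 'n \<Rightarrow> nat \<Rightarrow> real \<Rightarrow> real" where
    "u t l i s = (case t of Inl None \<Rightarrow> e i s
      | Inl (Some l0) \<Rightarrow> if l = l0 then sin (s - c $ l + real i * (pi / 2)) else e i s
      | Inr z \<Rightarrow> if l \<in> I then b i ((s - q z $ l) / r) / r ^ i else e i s)" for t l i s
  define w :: "'n option + 'z \<Rightarrow> real^'n" where
    "w t = (case t of Inl None \<Rightarrow> v0 | Inl (Some l0) \<Rightarrow> va l0 | Inr z \<Rightarrow> v z)" for t
  define S where "S = insert None (Some ` I) <+> Z"
  define G where "G = sep_sum u w S (\<lambda>_. 0)"
  have e': "(e j has_real_derivative e (Suc j) x) (at x)" for j x
    by (simp add: e_def[abs_def])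
  have sin': "((\<lambda>s. sin (s - a + real j * (pi / 2))) has_real_derivative
      sin (x - a + real (Suc j) * (pi / 2))) (at x)" for a j x
  proof -
    have "sin (x - a + real (Suc j) * (pi / 2)) = cos (x - a + real j * (pi / 2))"
    proof -
      have "x - a + real (Suc j) * (pi / 2) = (x - a + real j * (pi / 2)) + pi / 2" by (simp add: field_simps)
      then show ?thesis by (simp only: sin_add) simp
    qed
    then show ?thesis by (auto intro!: derivative_eq_intros)
  qed
  have b': "((\<lambda>s. b j ((s - a) / r) / r ^ j) has_real_derivative b (Suc j) ((x - a) / r) / r ^ Suc j) (at x)"
    if "j < k" for a j x
  proof -
    have "((\<lambda>s. (s - a) / r) has_real_derivative 1 / r) (at x)"
      using r by (auto intro!: derivative_eq_intros)
    from DERIV_chain2[OF b(1)[OF that] this] have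
      "((\<lambda>s. b j ((s - a) / r)) has_real_derivative b (Suc j) ((x - a) / r) * (1 / r)) (at x)" .
    from DERIV_cdivide[OF this, of "r ^ j"] show ?thesis by (simp add: mult_ac)
  qed
  have deriv: "(u t l j has_real_derivative u t l (Suc j) x) (at x)" if "t \<in> S" "j < k" for t l j x
  proof (cases t)
    case (Inl t')
    then show ?thesis using e' sin' by (cases t') (auto simp: u_def[abs_def])
  next
    case (Inr z)
    then show ?thesis using e' b' that(2) by (auto simp: u_def[abs_def])
  qed
  have cb: "continuous_on UNIV (\<lambda>s. b k ((s - a) / r) / r ^ k)" for a
    using r by (intro continuous_on_divide continuous_on_compose2[OF b(2)] continuous_on_diff
        continuous_on_const continuous_on_id) auto
  have cs: "continuous_on UNIV (\<lambda>s. sin (s - a + real k * (pi / 2)))" for a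
    by (intro continuous_intros)
  have ce: "continuous_on UNIV (e k)" by (auto simp: e_def[abs_def])
  have cont: "continuous_on UNIV (u t l k)" if "t \<in> S" for t l
  proof (cases t)
    case (Inl t')
    then show ?thesis using cs ce by (cases t'; cases "l = the t'") (auto simp: u_def[abs_def])
  next
    case (Inr z)
    then show ?thesis using cb ce by (cases "l \<in> I") (auto simp: u_def[abs_def])
  qed
  note ctx = deriv cont
  have fS: "finite S" using Z by (simp add: S_def)
  have wI: "w t $ l = 0" if "l \<in> I" for t l using vI that by (auto simp: w_def split: sum.split option.split)
  have GI: "G x $ l = 0" if "l \<in> I" for x l
    using wI[OF that] by (simp add: G_def sep_sum_def sum_component)
  have uI: "u t l 0 s = 1" if "t \<in> S" "l \<notin> I" for t l s
    using that by (auto simp: u_def e_def S_def split: sum.split option.split)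
  have Gdep: "G x = G y" if "\<And>l. l \<in> I \<Longrightarrow> x $ l = y $ l" for x y
    unfolding G_def sep_sum_def
  proof (rule sum.cong[OF refl])
    fix t assume "t \<in> S"
    then have "u t l 0 (x $ l) = u t l 0 (y $ l)" for l using that uI by (cases "l \<in> I") auto
    then show "(\<Prod>l\<in>UNIV. u t l 0 (x $ l)) *\<^sub>R w t = (\<Prod>l\<in>UNIV. u t l 0 (y $ l)) *\<^sub>R w t" by simp
  qed
  have "- G x = sep_sum u (\<lambda>t. - w t) S (\<lambda>_. 0) x" for x by (simp add: G_def sep_sum_def sum_negf)
  then have nG: "(\<lambda>x. - G x) = sep_sum u (\<lambda>t. - w t) S (\<lambda>_. 0)" by auto
  have diff: "Ck_diffeo_on k UNIV UNIV (\<lambda>x. x + G x)"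
  proof (rule shear_diffeo)
    show "Ck_on k UNIV G" unfolding G_def by (rule Ck_on_sep_sum[OF ctx]) auto
    show "Ck_on k UNIV (\<lambda>x. - G x)" unfolding nG by (rule Ck_on_sep_sum[OF ctx]) auto
    show "G (x + G x) = G x" "G (x - G x) = G x" for x by (rule Gdep; simp add: GI)+
  qed
  have bound: "norm (sep_sum u w S g x) \<le> norm v0 + (\<Sum>l\<in>I. norm (va l)) + M ^ CARD('n) / r ^ k * \<eta>"
    if g: "sum g UNIV \<le> k" for g x
  proof -
    let ?p = "\<lambda>t. \<Prod>l\<in>UNIV. u t l (g l) (x $ l)"
    have gk: "g l \<le> k" for l using g member_le_sum[of l UNIV g] by simp
    have e1: "\<bar>e i s\<bar> \<le> 1" for i s by (simp add: e_def)
    have p1: "\<bar>?p (Inl t)\<bar> \<le> 1" for t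
    proof -
      have "\<bar>u (Inl t) l (g l) (x $ l)\<bar> \<le> 1" for l
        using e1 by (auto simp: u_def split: option.split)
      then show ?thesis unfolding abs_prod by (intro prod_le_1) auto
    qed
    \<comment> \<open>\<open>M \<ge> 1\<close> and \<open>r \<le> 1\<close> let the constant factors
      satisfy the same bound as the bump factors, and allow the total order to be raised to
      \<open>k\<close>.\<close>
    have p2: "\<bar>?p (Inr z)\<bar> \<le> M ^ CARD('n) / r ^ k" for z
    proof -
      have "\<bar>u (Inr z) l (g l) (x $ l)\<bar> \<le> M / r ^ g l" for l
      proof (cases "l \<in> I")
        case True
        then show ?thesis using b(5)[OF gk] r by (simp add: u_def divide_right_mono)
      next
        case False
        have "1 \<le> M / r ^ g l" using r b(6) power_le_one[of r "g l"] by (simp add: field_simps)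
        then show ?thesis using False e1 by (simp add: u_def) (meson order_trans)
      qed
      then have "\<bar>?p (Inr z)\<bar> \<le> (\<Prod>l\<in>UNIV. M / r ^ g l)"
        unfolding abs_prod by (intro prod_mono) auto
      also have "\<dots> = M ^ CARD('n) / r ^ sum g UNIV" by (simp add: prod_dividef power_sum)
      also have "\<dots> \<le> M ^ CARD('n) / r ^ k"
        using r b(6) g by (intro divide_left_mono power_decreasing) auto
      finally show ?thesis .
    qed
    have p3: "\<bar>x $ l - q z $ l\<bar> < r" if "?p (Inr z) \<noteq> 0" "l \<in> I" for z l
    proof -
      have "u (Inr z) l (g l) (x $ l) \<noteq> 0" using that(1) by auto
      then have "\<bar>(x $ l - q z $ l) / r\<bar> < 1" using b(4) that(2) by (force simp: u_def)
      then show ?thesis using r by simp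
    qed
    have "norm (sep_sum u w S g x) \<le> (\<Sum>t\<in>S. \<bar>?p t\<bar> * norm (w t))"
      unfolding sep_sum_def by (rule order_trans[OF norm_sum]) simp
    also have "\<dots> = (\<Sum>t\<in>insert None (Some ` I). \<bar>?p (Inl t)\<bar> * norm (w (Inl t))) + (\<Sum>z\<in>Z. \<bar>?p (Inr z)\<bar> * norm (v z))"
      unfolding S_def using Z by (subst sum.Plus) (auto simp: w_def)
    also have "\<dots> \<le> (\<Sum>t\<in>insert None (Some ` I). norm (w (Inl t))) + M ^ CARD('n) / r ^ k * \<eta>"
    proof (rule add_mono)
      show "(\<Sum>t\<in>insert None (Some ` I). \<bar>?p (Inl t)\<bar> * norm (w (Inl t))) \<le> (\<Sum>t\<in>insert None (Some ` I). norm (w (Inl t)))"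
        by (intro sum_mono mult_left_le_one_le p1) auto
      show "(\<Sum>z\<in>Z. \<bar>?p (Inr z)\<bar> * norm (v z)) \<le> M ^ CARD('n) / r ^ k * \<eta>"
      proof (rule sum_at_most_one_le[OF Z])
        show "0 \<le> M ^ CARD('n) / r ^ k * \<eta>" using r b(6) \<eta> by simp
        show "\<bar>?p (Inr z)\<bar> * norm (v z) \<le> M ^ CARD('n) / r ^ k * \<eta>" if "z \<in> Z" for z
          using p2 \<eta>(1)[OF that] r b(6) by (intro mult_mono) auto
        fix z z' assume z: "z \<in> Z" "z' \<in> Z"
          and h: "\<bar>?p (Inr z)\<bar> * norm (v z) \<noteq> 0" "\<bar>?p (Inr z')\<bar> * norm (v z') \<noteq> 0"
        have nz: "?p (Inr z) \<noteq> 0" "?p (Inr z') \<noteq> 0" using h by (metis abs_0 mult_zero_left)+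
        show "z = z'"
        proof (rule ccontr)
          assume "z \<noteq> z'"
          then obtain l where l: "l \<in> I" "\<bar>q z $ l - q z' $ l\<bar> \<ge> 2 * r" using sep z by blast
          show False using p3[OF nz(1) l(1)] p3[OF nz(2) l(1)] l(2) by linarith
        qed
      qed
    qed
    also have "(\<Sum>t\<in>insert None (Some ` I). norm (w (Inl t))) = norm v0 + (\<Sum>l\<in>I. norm (va l))"
      by (subst sum.insert) (auto simp: w_def sum.reindex)
    finally show ?thesis .
  qed
  have val: "G x = v0 + (\<Sum>l\<in>I. sin (q z $ l - c $ l) *\<^sub>R va l) + v z"
    if z: "z \<in> Z" and x: "\<And>l. l \<in> I \<Longrightarrow> x $ l = q z $ l" for z x
  proof -
    let ?p = "\<lambda>t. \<Prod>l\<in>UNIV. u t l 0 (x $ l)"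
    have p1: "?p (Inl None) = 1" by (simp add: u_def e_def)
    have p2: "?p (Inl (Some l)) = sin (q z $ l - c $ l)" if "l \<in> I" for l
    proof -
      have "?p (Inl (Some l)) = (\<Prod>l'\<in>UNIV. if l' = l then sin (q z $ l - c $ l) else 1)"
        by (rule prod.cong) (use x that in \<open>auto simp: u_def e_def\<close>)
      then show ?thesis by simp
    qed
    have p3: "?p (Inr z) = 1" by (rule prod.neutral) (use x b(3) in \<open>auto simp: u_def e_def\<close>)
    have p4: "?p (Inr z') = 0" if z': "z' \<in> Z" "z' \<noteq> z" for z'
    proof -
      obtain l where l: "l \<in> I" "\<bar>q z $ l - q z' $ l\<bar> \<ge> 2 * r" using sep z z' by blast
      then have "\<bar>(x $ l - q z' $ l) / r\<bar> \<ge> 1" using x r by (simp add: field_simps)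
      then have "u (Inr z') l 0 (x $ l) = 0" using b(4) l by (simp add: u_def)
      then show ?thesis by (intro prod_zero) auto
    qed
    have "G x = (\<Sum>t\<in>insert None (Some ` I). ?p (Inl t) *\<^sub>R w (Inl t)) + (\<Sum>z\<in>Z. ?p (Inr z) *\<^sub>R v z)"
      unfolding G_def sep_sum_def S_def using Z by (subst sum.Plus) (auto simp: w_def)
    also have "(\<Sum>z\<in>Z. ?p (Inr z) *\<^sub>R v z) = v z"
    proof -
      have "(\<Sum>z'\<in>Z - {z}. ?p (Inr z') *\<^sub>R v z') = 0"
        by (rule sum.neutral, rule ballI, subst p4) auto
      then show ?thesis using z Z p3 by (subst sum.remove[of Z z]) auto
    qed
    also have "(\<Sum>t\<in>insert None (Some ` I). ?p (Inl t) *\<^sub>R w (Inl t)) = v0 + (\<Sum>l\<in>I. sin (q z $ l - c $ l) *\<^sub>R va l)"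
      using p1 p2 by (subst sum.insert) (auto simp: w_def sum.reindex intro!: sum.cong)
    finally show ?thesis .
  qed
  show ?thesis
  proof (rule that[OF diff _ GI val])
    fix "is" :: "'n list" and x assume len: "length is \<le> k"
    obtain g where "sum g UNIV = length is" "iter_partial is G = sep_sum u w S g"
      using iter_partial_sep_sum[where u = u and S = S and k = k and c = "\<lambda>_. 0" and v = w, OF ctx] len unfolding G_def by fastforce
    then show "norm (iter_partial is G x) \<le> norm v0 + (\<Sum>l\<in>I. norm (va l)) + M ^ CARD('n) / r ^ k * \<eta>"
      using bound[of g x] len by simp
  qed
qed

section \<open>Lattice points at one fixed scale\<close>

lemma abs_sin_diff_ge:
  fixes a b :: real
  assumes "a \<in> {0..1}" "b \<in> {0..1}"
  shows "\<bar>a - b\<bar> / 2 \<le> \<bar>sin a - sin b\<bar>"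
proof -
  have *: "(y - x) / 2 \<le> sin y - sin x" if "0 \<le> x" "x \<le> y" "y \<le> 1" for x y :: real
  proof (cases "x = y")
    case False
    then have "x < y" using that by simp
    then obtain z where z: "x < z" "z < y" "sin y - sin x = (y - x) * cos z"
      using MVT2[of x y sin cos] by (auto intro: DERIV_sin)
    \<comment> \<open>This uses \<open>z < 1 < pi / 3\<close>.\<close>
    have "cos (pi / 3) \<le> cos z" using z that pi_gt3 by (intro cos_monotone_0_pi_le) auto
    then have "1 / 2 \<le> cos z" by (simp add: cos_60)
    then show ?thesis using z(3) \<open>x < y\<close> mult_left_mono[of "1 / 2" "cos z" "y - x"] by simp
  qed simp
  show ?thesis
    using *[of a b] *[of b a] assms by (cases "a \<le> b") (auto simp: abs_if)
qed

lemma norm_le_CARD_mult: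
  fixes x :: "real^'n::finite"
  assumes "\<And>j. \<bar>x $ j\<bar> \<le> B"
  shows "norm x \<le> real CARD('n) * B"
  using norm_le_l1_cart[of x] sum_mono[of UNIV "\<lambda>j. \<bar>x $ j\<bar>" "\<lambda>_. B"] assms by simp

text \<open>Candidates are \<open>N\<close> lattice steps apart, with \<open>w\<close> of them along
  each side of a cell and \<open>T\<close> cells along each side of the box.
  \<open>\<alpha>N\<close> separates the candidates of a cell, \<open>fits\<close> keeps them in the
  box, and \<open>Lw\<close> feeds the second moment estimate. The three summands of the norm bound
  come from the translation, the sines and the bumps.\<close>

lemma many_lattice_points_at_scale:
  fixes \<Sigma> :: "(real^'n::finite) set" and I :: "'n set" and c :: "real^'n"
    and N w T L k :: nat and R \<rho> \<alpha> M :: real and b :: "nat \<Rightarrow> real \<Rightarrow> real"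
  assumes b: "\<And>j t. j < k \<Longrightarrow> (b j has_real_derivative b (Suc j) t) (at t)"
    "continuous_on UNIV (b k)" "b 0 0 = 1" "\<And>j t. \<bar>t\<bar> \<ge> 1 \<Longrightarrow> b j t = 0"
    "\<And>j t. j \<le> k \<Longrightarrow> \<bar>b j t\<bar> \<le> M" "M \<ge> 1"
    and cpt: "compact \<Sigma>" and \<rho>: "0 < \<rho>" "\<rho> \<le> 1"
    and box: "\<And>x. (\<And>l. l \<in> I \<Longrightarrow> \<bar>x $ l - c $ l\<bar> \<le> \<rho>) \<Longrightarrow> \<exists>p\<in>\<Sigma>. \<forall>l\<in>I. p $ l = x $ l"
    and pos: "N > 0" "w > 0" "T > 0" "L > 0" "R > 0" "\<alpha> > 0" and \<alpha>N: "\<alpha> * real N \<ge> 2"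
    and fits: "1 + 2 * real N * real w * real T \<le> R * \<rho>"
    and Lw: "2 * 9 ^ card (- I) * real w ^ card I \<le> real L ^ card (- I)"
  obtains \<Phi> where "Ck_diffeo_on k UNIV UNIV \<Phi>"
    "\<And>is x. length is \<le> k \<Longrightarrow> norm (iter_partial is (\<lambda>y. \<Phi> y - y) x) \<le>
       real CARD('n) / R + real CARD('n) ^ 2 * \<alpha> +
       M ^ CARD('n) * (2 * R / (real N * real w)) ^ k * (real CARD('n) / (real L * R))"
    "real T ^ card I * real w ^ card I / (2 * real L ^ card (- I)) \<le> real (card (\<Phi> ` \<Sigma> \<inter> scaled_lattice R))"
proof -
  define Z where "Z = (I \<rightarrow>\<^sub>E {..<T})"
  define Y where "Y = (I \<rightarrow>\<^sub>E {..<w})"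
  \<comment> \<open>Cells repeat with period \<open>2 * w\<close> but candidates fill only
    \<open>w\<close> of it, so candidates of different cells are at least \<open>N * w\<close>
    lattice steps apart in some coordinate. Rounding \<open>c\<close> up to the lattice costs the
    \<open>1\<close> in \<open>fits\<close>.\<close>
  define A :: "('n \<Rightarrow> nat) \<Rightarrow> ('n \<Rightarrow> nat) \<Rightarrow> 'n \<Rightarrow> int" where
    "A z y l = \<lceil>R * c $ l\<rceil> + int N * (2 * int w * int (z l) + int (y l))" for z y l
  define Q where "Q z y = (\<chi> l. real_of_int (A z y l) / R)" for z y
  have RQ: "R * Q z y $ l = of_int (A z y l)" for z y l using pos by (simp add: Q_def)
  have Qc: "0 \<le> Q z y $ l - c $ l" "Q z y $ l - c $ l \<le> \<rho>" if "z \<in> Z" "y \<in> Y" "l \<in> I" for z y l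
  proof -
    have zy: "z l < T" "y l < w" using that by (auto simp: Z_def Y_def PiE_def Pi_def)
    then have "2 * w * z l + y l \<le> 2 * w * T"
    proof -
      have "w * (z l + 1) \<le> w * T" using zy by (intro mult_le_mono2) simp
      then show ?thesis using zy by (simp add: algebra_simps)
    qed
    then have "N * (2 * w * z l + y l) \<le> N * (2 * w * T)" by (rule mult_le_mono2)
    then have "real (N * (2 * w * z l + y l)) \<le> real (N * (2 * w * T))" by (rule of_nat_mono)
    then have "of_int (A z y l) \<le> R * c $ l + 1 + 2 * real N * real w * real T"
      unfolding A_def using of_int_ceiling_le_add_one[of "R * c $ l"] by (simp add: algebra_simps)
    then have up: "R * (Q z y $ l - c $ l) \<le> R * \<rho>" using fits RQ[of z y l] by (simp add: algebra_simps)
    have "real_of_int \<lceil>R * c $ l\<rceil> \<le> of_int (A z y l)" unfolding A_def by (intro of_int_le_iff[THEN iffD2]) simp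
    then have "R * c $ l \<le> of_int (A z y l)" using le_of_int_ceiling[of "R * c $ l"] by linarith
    then have lo: "R * 0 \<le> R * (Q z y $ l - c $ l)"
      using RQ[of z y l] by (simp add: algebra_simps)
    show "0 \<le> Q z y $ l - c $ l" "Q z y $ l - c $ l \<le> \<rho>" using up lo pos(5) mult_le_cancel_left_pos by blast+
  qed
  have "\<exists>p\<in>\<Sigma>. \<forall>l\<in>I. p $ l = Q z y $ l" if "z \<in> Z" "y \<in> Y" for z y
    using Qc[OF that] by (intro box) (simp add: abs_of_nonneg)
  then obtain p where p: "\<And>z y. z \<in> Z \<Longrightarrow> y \<in> Y \<Longrightarrow> p z y \<in> \<Sigma> \<and> (\<forall>l\<in>I. p z y $ l = Q z y $ l)" by metis
  \<comment> \<open>From here on heights are measured in units of \<open>1 / R\<close>, so that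
    lattice points have integer coordinates.\<close>
  define F where "F z y j = R * p z y $ j" for z y j
  define s where "s z y l = R * \<alpha> * sin (Q z y $ l - c $ l)" for z y l
  have fin: "finite Z" "finite Y" "finite I" "finite (- I)" by (auto simp: Z_def Y_def finite_PiE)
  have cards: "card Z = T ^ card I" "card Y = w ^ card I" by (auto simp: Z_def Y_def card_PiE)
  \<comment> \<open>Different candidates are at least \<open>N / R\<close> apart in some coordinate.
    The sine at most halves this distance, and the factor \<open>R * \<alpha>\<close> makes it at
    least \<open>\<alpha> * N / 2 \<ge> 1\<close>.\<close>
  have sepY: "\<exists>l\<in>I. \<bar>s z y l - s z y' l\<bar> \<ge> 1" if h: "z \<in> Z" "y \<in> Y" "y' \<in> Y" "y \<noteq> y'" for z y y'
  proof -
    obtain l where l: "l \<in> I" "y l \<noteq> y' l" using h PiE_ext[of y I "\<lambda>_. {..<w}" y'] unfolding Y_def by blast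
    have "\<bar>A z y l - A z y' l\<bar> = int N * \<bar>int (y l) - int (y' l)\<bar>"
      by (simp add: A_def abs_mult flip: right_diff_distrib)
    also have "\<dots> \<ge> int N * 1" using l by (intro mult_left_mono) auto
    finally have "real_of_int (int N) \<le> of_int \<bar>A z y l - A z y' l\<bar>" by (simp only: of_int_le_iff mult_1_right)
    then have "real N \<le> \<bar>R * Q z y $ l - R * Q z y' $ l\<bar>" by (simp add: RQ)
    also have "\<dots> = R * \<bar>(Q z y $ l - c $ l) - (Q z y' $ l - c $ l)\<bar>"
      using pos by (simp add: abs_mult flip: right_diff_distrib)
    also have "\<dots> \<le> R * (2 * \<bar>sin (Q z y $ l - c $ l) - sin (Q z y' $ l - c $ l)\<bar>)"
      using abs_sin_diff_ge[of "Q z y $ l - c $ l" "Q z y' $ l - c $ l"] Qc[OF h(1,2) l(1)] Qc[OF h(1,3) l(1)] \<rho> pos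
      by (intro mult_left_mono) auto
    finally have "\<alpha> * real N \<le> \<alpha> * (R * (2 * \<bar>sin (Q z y $ l - c $ l) - sin (Q z y' $ l - c $ l)\<bar>))"
      using pos by (intro mult_left_mono) auto
    also have "\<dots> = 2 * \<bar>s z y l - s z y' l\<bar>"
      using pos by (simp add: s_def abs_mult flip: right_diff_distrib)
    finally show ?thesis using \<alpha>N l by (intro bexI[of _ l]) auto
  qed
  obtain \<tau> a where \<tau>: "\<And>j. j \<in> - I \<Longrightarrow> 0 \<le> \<tau> j \<and> \<tau> j \<le> 1"
    and a: "\<And>j l. j \<in> - I \<Longrightarrow> l \<in> I \<Longrightarrow> 0 \<le> a j l \<and> a j l \<le> 1"
    and many: "real (card Z) * real (card Y) / (2 * real L ^ card (- I))
      \<le> real (card {z \<in> Z. \<exists>y\<in>Y. \<forall>j\<in>- I. frac (F z y j + \<tau> j + (\<Sum>l\<in>I. a j l * s z y l)) < 1 / real L})"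
    by (rule exists_shear_with_many_good_cells[OF fin pos(4), where s = s and F = F, OF sepY])
       (use Lw in \<open>auto simp: cards\<close>)
  define X where "X z y j = F z y j + \<tau> j + (\<Sum>l\<in>I. a j l * s z y l)" for z y j
  define Zg where "Zg = {z \<in> Z. \<exists>y\<in>Y. \<forall>j\<in>- I. frac (X z y j) < 1 / real L}"
  obtain y where y: "\<And>z. z \<in> Zg \<Longrightarrow> y z \<in> Y \<and> (\<forall>j\<in>- I. frac (X z (y z) j) < 1 / real L)"
    unfolding Zg_def by (atomize_elim, rule choice) auto
  have ZgZ: "Zg \<subseteq> Z" by (auto simp: Zg_def)
  then have fg: "finite Zg" using fin finite_subset by blast
  \<comment> \<open>Half of the guaranteed distance \<open>N * w / R\<close> between chosen
    candidates of different cells.\<close>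
  define r where "r = real N * real w / (2 * R)"
  have r0: "0 < r" using pos by (simp add: r_def)
  have r1: "r \<le> 1"
  proof -
    have "real N * real w * 1 \<le> real N * real w * real T" using pos by (intro mult_left_mono) auto
    moreover have "R * \<rho> \<le> R * 1" using \<rho> pos by (intro mult_left_mono) auto
    moreover have "0 \<le> real N * real w" by simp
    ultimately have "real N * real w \<le> 2 * R" using fits pos by linarith
    then show ?thesis using pos by (simp add: r_def)
  qed
  define q where "q z = Q z (y z)" for z
  define v0 :: "real^'n" where "v0 = (\<chi> j. if j \<in> I then 0 else \<tau> j / R)"
  define va :: "'n \<Rightarrow> real^'n" where "va l = (\<chi> j. if j \<in> I \<or> l \<notin> I then 0 else \<alpha> * a j l)" for l
  \<comment> \<open>The bump at \<open>q z\<close> lowers every coordinate outside \<open>I\<close>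
    to the next lattice value below; for a good candidate this is a move of less than
    \<open>1 / (L * R)\<close>.\<close>
  define v :: "('n \<Rightarrow> nat) \<Rightarrow> real^'n" where "v z = (\<chi> j. if j \<in> I then 0 else - frac (X z (y z) j) / R)" for z
  define \<eta> where "\<eta> = real CARD('n) / (real L * R)"
  have sepZ: "\<exists>l\<in>I. \<bar>q z $ l - q z' $ l\<bar> \<ge> 2 * r" if h: "z \<in> Zg" "z' \<in> Zg" "z \<noteq> z'" for z z'
  proof -
    have zz: "z \<in> Z" "z' \<in> Z" "y z \<in> Y" "y z' \<in> Y" using h ZgZ y by auto
    then obtain l where l: "l \<in> I" "z l \<noteq> z' l" using h(3) PiE_ext[of z I "\<lambda>_. {..<T}" z'] unfolding Z_def by blast
    have yl: "y z l < w" "y z' l < w" using zz l by (auto simp: Y_def PiE_def Pi_def)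
    define D where "D = int (z l) - int (z' l)"
    have "\<bar>D\<bar> \<ge> 1" using l by (auto simp: D_def)
    then have "2 * int w * 1 \<le> 2 * int w * \<bar>D\<bar>" by (intro mult_left_mono) auto
    also have "\<dots> = \<bar>2 * int w * D\<bar>" by (simp add: abs_mult)
    finally have ge: "int w \<le> \<bar>2 * int w * D + (int (y z l) - int (y z' l))\<bar>" using yl by linarith
    have "A z (y z) l - A z' (y z') l = int N * (2 * int w * D + (int (y z l) - int (y z' l)))"
      by (simp add: A_def D_def algebra_simps)
    then have "\<bar>A z (y z) l - A z' (y z') l\<bar> = int N * \<bar>2 * int w * D + (int (y z l) - int (y z' l))\<bar>"
      by (simp add: abs_mult)
    also have "\<dots> \<ge> int N * int w" using ge by (intro mult_left_mono) auto
    finally have "real_of_int (int N * int w) \<le> of_int \<bar>A z (y z) l - A z' (y z') l\<bar>" by (simp only: of_int_le_iff)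
    then have "real N * real w \<le> \<bar>R * q z $ l - R * q z' $ l\<bar>" by (simp add: RQ q_def)
    also have "\<dots> = R * \<bar>q z $ l - q z' $ l\<bar>" using pos by (simp add: abs_mult flip: right_diff_distrib)
    finally show ?thesis using pos l by (intro bexI[of _ l]) (auto simp: r_def field_simps)
  qed
  have nv: "norm (v z) \<le> \<eta>" if "z \<in> Zg" for z
  proof -
    have "\<bar>v z $ j\<bar> \<le> 1 / (real L * R)" for j
    proof (cases "j \<in> I")
      case False
      then have "frac (X z (y z) j) < 1 / real L" using y[OF that] by blast
      then have "frac (X z (y z) j) / R \<le> 1 / real L / R" using pos by (intro divide_right_mono) auto
      then show ?thesis using False pos frac_ge_0[of "X z (y z) j"] by (simp add: v_def)
    qed (use pos in \<open>simp add: v_def\<close>)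
    then show ?thesis using norm_le_CARD_mult[of "v z" "1 / (real L * R)"] by (simp add: \<eta>_def)
  qed
  have n0: "norm v0 \<le> real CARD('n) * (1 / R)"
    using \<tau> pos by (intro norm_le_CARD_mult) (auto simp: v0_def divide_right_mono)
  have na: "(\<Sum>l\<in>I. norm (va l)) \<le> real CARD('n) ^ 2 * \<alpha>"
  proof -
    have "norm (va l) \<le> real CARD('n) * \<alpha>" for l
    proof (rule norm_le_CARD_mult)
      fix j show "\<bar>va l $ j\<bar> \<le> \<alpha>"
        using a[of j l] pos mult_left_mono[of "a j l" 1 \<alpha>] by (auto simp: va_def abs_mult)
    qed
    then have "(\<Sum>l\<in>I. norm (va l)) \<le> real (card I) * (real CARD('n) * \<alpha>)"
      using sum_bounded_above[of I "\<lambda>l. norm (va l)"] by simp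
    also have "\<dots> \<le> real CARD('n) * (real CARD('n) * \<alpha>)"
      using pos by (intro mult_right_mono) (auto simp: card_mono)
    finally show ?thesis by (simp add: power2_eq_square)
  qed
  obtain G where G: "Ck_diffeo_on k UNIV UNIV (\<lambda>x. x + G x)"
    "\<And>is x. length is \<le> k \<Longrightarrow>
       norm (iter_partial is G x) \<le> norm v0 + (\<Sum>l\<in>I. norm (va l)) + M ^ CARD('n) / r ^ k * \<eta>"
    "\<And>x l. l \<in> I \<Longrightarrow> G x $ l = 0"
    "\<And>z x. z \<in> Zg \<Longrightarrow> (\<And>l. l \<in> I \<Longrightarrow> x $ l = q z $ l) \<Longrightarrow>
       G x = v0 + (\<Sum>l\<in>I. sin (q z $ l - c $ l) *\<^sub>R va l) + v z"
    by (rule shear_perturbation[where b = b and k = k and M = M and Z = Zg and r = r and I = I and ?v0.0 = v0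
          and va = va and v = v and q = q and \<eta> = \<eta> and c = c, OF b fg r0 r1 _ _ _ sepZ nv])
       (use pos in \<open>auto simp: v0_def va_def v_def \<eta>_def\<close>)
  define \<Phi> where "\<Phi> x = x + G x" for x
  have pz: "p z (y z) \<in> \<Sigma>" "\<And>l. l \<in> I \<Longrightarrow> p z (y z) $ l = q z $ l" if "z \<in> Zg" for z
    using p[of z "y z"] that ZgZ y by (auto simp: q_def)
  have lat: "\<Phi> (p z (y z)) \<in> scaled_lattice R" if z: "z \<in> Zg" for z
    unfolding scaled_lattice_def
  proof (intro CollectI allI)
    fix j
    show "R * \<Phi> (p z (y z)) $ j \<in> \<int>"
    proof (cases "j \<in> I")
      case True
      then show ?thesis using pz(2)[OF z True] G(3) by (simp add: \<Phi>_def q_def RQ)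
    next
      case False
      have "G (p z (y z)) $ j = \<tau> j / R + (\<Sum>l\<in>I. sin (q z $ l - c $ l) * (\<alpha> * a j l)) - frac (X z (y z) j) / R"
        using False by (simp add: G(4)[OF z pz(2)[OF z]] v0_def va_def v_def sum_component)
      then have "R * \<Phi> (p z (y z)) $ j = F z (y z) j + \<tau> j + R * (\<Sum>l\<in>I. sin (q z $ l - c $ l) * (\<alpha> * a j l)) - frac (X z (y z) j)"
        using pos by (simp add: \<Phi>_def F_def distrib_left right_diff_distrib)
      also have "R * (\<Sum>l\<in>I. sin (q z $ l - c $ l) * (\<alpha> * a j l)) = (\<Sum>l\<in>I. a j l * s z (y z) l)"
        by (simp add: sum_distrib_left s_def q_def mult_ac)
      finally have "R * \<Phi> (p z (y z)) $ j = of_int \<lfloor>X z (y z) j\<rfloor>" by (simp add: X_def frac_def)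
      then show ?thesis by simp
    qed
  qed
  \<comment> \<open>\<open>\<Phi>\<close> fixes the coordinates in \<open>I\<close>, and these
    already distinguish the chosen candidates.\<close>
  have inj: "inj_on (\<lambda>z. \<Phi> (p z (y z))) Zg"
  proof (rule inj_onI, rule ccontr)
    fix z z' assume h: "z \<in> Zg" "z' \<in> Zg" "\<Phi> (p z (y z)) = \<Phi> (p z' (y z'))" "z \<noteq> z'"
    obtain l where l: "l \<in> I" "\<bar>q z $ l - q z' $ l\<bar> \<ge> 2 * r" using sepZ h by blast
    have "\<Phi> (p z (y z)) $ l = q z $ l" "\<Phi> (p z' (y z')) $ l = q z' $ l"
      using pz(2)[OF h(1) l(1)] pz(2)[OF h(2) l(1)] G(3)[OF l(1)] by (simp_all add: \<Phi>_def)
    then show False using h l r0 by simp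
  qed
  show ?thesis
  proof (rule that[of \<Phi>])
    show d: "Ck_diffeo_on k UNIV UNIV \<Phi>" using G(1) by (simp add: \<Phi>_def[abs_def])
    show "norm (iter_partial is (\<lambda>y. \<Phi> y - y) x) \<le>
       real CARD('n) / R + real CARD('n) ^ 2 * \<alpha> +
       M ^ CARD('n) * (2 * R / (real N * real w)) ^ k * (real CARD('n) / (real L * R))"
      if "length is \<le> k" for "is" :: "'n list" and x
    proof -
      have "(\<lambda>y. \<Phi> y - y) = G" by (auto simp: \<Phi>_def)
      moreover have "M ^ CARD('n) / r ^ k = M ^ CARD('n) * (2 * R / (real N * real w)) ^ k"
        using pos by (simp add: r_def power_divide)
      ultimately show ?thesis using G(2)[OF that, of x] n0 na by (simp add: \<eta>_def)
    qed
    have "continuous_on \<Sigma> \<Phi>"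
      using d Ck_on_continuous unfolding Ck_diffeo_on_def by (metis continuous_on_subset subset_UNIV)
    then have "bounded (\<Phi> ` \<Sigma>)" using cpt compact_continuous_image compact_imp_bounded by blast
    then have "finite (\<Phi> ` \<Sigma> \<inter> scaled_lattice R)" using pos finite_bounded_Int_scaled_lattice by blast
    moreover have "(\<lambda>z. \<Phi> (p z (y z))) ` Zg \<subseteq> \<Phi> ` \<Sigma> \<inter> scaled_lattice R" using lat pz(1) by auto
    ultimately have "card Zg \<le> card (\<Phi> ` \<Sigma> \<inter> scaled_lattice R)" using card_inj_on_le[OF inj] by blast
    then show "real T ^ card I * real w ^ card I / (2 * real L ^ card (- I)) \<le> real (card (\<Phi> ` \<Sigma> \<inter> scaled_lattice R))"
      using many unfolding Zg_def X_def cards by simp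
  qed
qed

section \<open>Choice of the parameters as functions of \<open>R\<close>\<close>

theorem theorem6p4:
  fixes \<Sigma> :: "(real^'n::finite) set" and m k :: nat and \<epsilon> :: real
  assumes "CARD('n) \<ge> 2" and "1 \<le> m" and "m < CARD('n)" and "k \<ge> 2"
    and "compact \<Sigma>" and "\<Sigma> \<noteq> {}" and "Ck_submanifold k m \<Sigma>"
    and "\<epsilon> > 0"
  shows "\<exists>C c. C > 0 \<and> c > 0 \<and>
    (\<forall>R \<ge> C. \<exists>\<Sigma>' :: (real^'n) set. Ck_submanifold k m \<Sigma>' \<and> Ck_close k \<epsilon> \<Sigma> \<Sigma>' \<and>
       c * R powr (real m * real CARD('n) / (real m + real k * (real CARD('n) - real m)))
         \<le> real (card (\<Sigma>' \<inter> scaled_lattice R)))"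
proof -
  have k1: "k \<ge> 1" using assms(4) by simp
  obtain I :: "'n set" and c :: "real^'n" and \<rho> :: real where I: "card I = m" and \<rho>: "0 < \<rho>" "\<rho> \<le> 1"
    and box: "\<And>x. (\<And>l. l \<in> I \<Longrightarrow> \<bar>x $ l - c $ l\<bar> \<le> \<rho>) \<Longrightarrow> \<exists>p\<in>\<Sigma>. \<forall>l\<in>I. p $ l = x $ l"
    by (rule Ck_submanifold_projection_box[OF assms(7) k1 assms(6)]) blast
  obtain b :: "nat \<Rightarrow> real \<Rightarrow> real" and M where
    b: "\<And>j t. j < k \<Longrightarrow> (b j has_real_derivative b (Suc j) t) (at t)"
    "continuous_on UNIV (b k)" "b 0 0 = 1" "\<And>j t. \<bar>t\<bar> \<ge> 1 \<Longrightarrow> b j t = 0"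
    "\<And>j t. j \<le> k \<Longrightarrow> \<bar>b j t\<bar> \<le> M" "M \<ge> 1"
    using Ck_bump_exists[of k] by blast
  define n where "n = real CARD('n)"
  define d where "d = card (- I)"
  have dn: "real d = n - real m" "d \<ge> 1"
    using I assms(3) by (simp_all add: d_def n_def Compl_eq_Diff_UNIV card_Diff_subset)
  have n2: "n \<ge> 2" using assms(1) by (simp add: n_def)
  \<comment> \<open>Chosen so that the sines use up exactly \<open>\<epsilon> / 4\<close>.\<close>
  define \<alpha> where "\<alpha> = \<epsilon> / (4 * n ^ 2)"
  have \<alpha>0: "\<alpha> > 0" using assms(8) n2 by (simp add: \<alpha>_def)
  define N where "N = nat \<lceil>2 / \<alpha>\<rceil>"
  have N: "real N \<ge> 2 / \<alpha>" unfolding N_def by linarith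
  have N0: "N > 0" using N \<alpha>0 by (metis divide_pos_pos gr0I not_le of_nat_0 zero_less_numeral)
  have \<alpha>N: "\<alpha> * real N \<ge> 2" using N \<alpha>0 by (simp add: field_simps)
  \<comment> \<open>The second entry brings the contribution of the bumps down to
    \<open>\<epsilon> / 4\<close> in \<open>small\<close>.\<close>
  define K where "K = max 1 (4 * n * M ^ CARD('n) * 2 ^ k / \<epsilon>)"
  have K1: "K \<ge> 1" by (simp add: K_def)
  define D where "D = real k * real d + real m"
  have D0: "D > 0" using assms(2) by (simp add: D_def add_nonneg_pos)
  \<comment> \<open>With \<open>L\<close> of order \<open>w powr (m / d)\<close>, the balance of
    \<open>L * w ^ k\<close> and \<open>R ^ (k - 1)\<close> reads \<open>w powr (D / d)\<close> of
    order \<open>R ^ (k - 1)\<close>, so \<open>w\<close> has order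
    \<open>R powr \<theta>\<close>.\<close>
  define \<theta> where "\<theta> = (real k - 1) * real d / D"
  have \<theta>0: "\<theta> \<ge> 0" using assms(4) D0 by (simp add: \<theta>_def)
  have \<theta>1: "1 - \<theta> = n / D" using D0 dn(1) by (simp add: \<theta>_def field_simps) (simp add: D_def algebra_simps)
  have \<theta>1': "1 - \<theta> > 0" using \<theta>1 n2 D0 by simp
  \<comment> \<open>The \<open>8\<close> combines the \<open>2\<close> in \<open>fits\<close>, the
    bound \<open>R * \<rho> - 1 \<ge> R * \<rho> / 2\<close> and
    \<open>w \<le> 2 * K * R powr \<theta>\<close>.\<close>
  define \<kappa> where "\<kappa> = \<rho> / (8 * real N * K)"
  have \<kappa>0: "\<kappa> > 0" using \<rho> N0 K1 by (simp add: \<kappa>_def)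
  \<comment> \<open>Beyond \<open>R \<ge> 1\<close>, the thresholds make the translation cost at
    most \<open>\<epsilon> / 4\<close>, make \<open>R * \<rho> - 1\<close> at least
    \<open>R * \<rho> / 2\<close>, and make \<open>x \<ge> 1\<close>, so that \<open>T\<close> is
    positive.\<close>
  define C where "C = max (max 1 (4 * n / \<epsilon>)) (max (2 / \<rho>) ((1 / \<kappa>) powr (1 / (1 - \<theta>))))"
  \<comment> \<open>Rounding \<open>x\<close> down to \<open>T\<close> loses the factor
    \<open>2\<close> in \<open>\<kappa> / 2\<close>. The power of \<open>19\<close> comes from
    \<open>L \<le> 19 * W\<close>, and the powers of \<open>w\<close> cancel because
    \<open>W ^ d = w ^ m\<close>.\<close>
  define c' where "c' = (\<kappa> / 2) ^ m / (2 * 19 ^ d)"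
  have main: "\<exists>\<Sigma>' :: (real^'n) set. Ck_submanifold k m \<Sigma>' \<and> Ck_close k \<epsilon> \<Sigma> \<Sigma>' \<and>
       c' * R powr (real m * real CARD('n) / (real m + real k * (real CARD('n) - real m)))
         \<le> real (card (\<Sigma>' \<inter> scaled_lattice R))" if R: "R \<ge> C" for R
  proof -
    have R1: "R \<ge> 1" "R \<ge> 4 * n / \<epsilon>" "R \<ge> 2 / \<rho>" "R \<ge> (1 / \<kappa>) powr (1 / (1 - \<theta>))"
      using R by (auto simp: C_def)
    have R0: "R > 0" using R1 by simp
    have R\<theta>: "R powr \<theta> \<ge> 1" using R1 \<theta>0 by (simp add: ge_one_powr_ge_zero)
    define w where "w = nat \<lceil>K * R powr \<theta>\<rceil>"
    have KR: "K * R powr \<theta> \<ge> 1" using mult_mono[OF K1 R\<theta>] K1 by simp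
    have w_lo: "K * R powr \<theta> \<le> real w" unfolding w_def by linarith
    have w_hi: "real w \<le> 2 * (K * R powr \<theta>)" unfolding w_def using KR by linarith
    have w1: "real w \<ge> 1" using w_lo KR by linarith
    define W where "W = real w powr (real m / real d)"
    have W1: "W \<ge> 1" using w1 by (simp add: W_def ge_one_powr_ge_zero)
    \<comment> \<open>As \<open>d \<ge> 1\<close>, the base \<open>18\<close> gives
      \<open>2 * 9 ^ d \<le> 18 ^ d\<close>, which is what \<open>Lw\<close> asks for.\<close>
    define L where "L = nat \<lceil>18 * W\<rceil>"
    have L_lo: "18 * W \<le> real L" unfolding L_def by linarith
    have L_hi: "real L \<le> 19 * W" unfolding L_def using W1 by linarith
    have L0: "L > 0" using L_lo W1 by (metis gr0I not_le of_nat_0 less_le_trans zero_less_numeral mult_pos_pos zero_less_one)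
    have Wd: "W ^ d = real w ^ m"
      using w1 dn(2) by (simp add: W_def powr_powr flip: powr_realpow)
    \<comment> \<open>The largest real value of \<open>T\<close> that \<open>fits\<close>
      permits.\<close>
    define x where "x = (R * \<rho> - 1) / (2 * real N * real w)"
    define T where "T = nat \<lfloor>x\<rfloor>"
    have xlo: "x \<ge> \<kappa> * R powr (1 - \<theta>)"
    proof -
      have "R * \<rho> / 2 \<le> R * \<rho> - 1" using R1(3) \<rho> by (simp add: field_simps)
      moreover have "2 * real N * real w \<le> 2 * real N * (2 * (K * R powr \<theta>))" using w_hi by (intro mult_left_mono) auto
      moreover have "0 < 2 * real N * real w" using N0 w1 by simp
      moreover have "0 \<le> R * \<rho> / 2" using R0 \<rho> by simp
      ultimately have "(R * \<rho> / 2) / (2 * real N * (2 * (K * R powr \<theta>))) \<le> x"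
        unfolding x_def by (intro frac_le) auto
      moreover have "(R * \<rho> / 2) / (2 * real N * (2 * (K * R powr \<theta>))) = \<kappa> * R powr (1 - \<theta>)"
        using R0 N0 K1 by (simp add: \<kappa>_def powr_diff field_simps)
      ultimately show ?thesis by simp
    qed
    have "1 / \<kappa> \<le> R powr (1 - \<theta>)"
    proof -
      have "((1 / \<kappa>) powr (1 / (1 - \<theta>))) powr (1 - \<theta>) \<le> R powr (1 - \<theta>)"
        using R1(4) \<theta>1' by (intro powr_mono2) auto
      then show ?thesis using \<theta>1' \<kappa>0 by (simp add: powr_powr)
    qed
    then have x1: "\<kappa> * R powr (1 - \<theta>) \<ge> 1" using \<kappa>0 by (simp add: field_simps)
    have "1 \<le> \<lfloor>x\<rfloor>" using x1 xlo by (simp add: le_floor_iff)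
    then have "1 \<le> real T" "x < real T + 1" unfolding T_def using real_of_int_floor_add_one_gt[of x] by auto
    then have "x \<le> 2 * real T" by linarith
    then have T_lo: "\<kappa> / 2 * R powr (1 - \<theta>) \<le> real T" using xlo by simp
    have T_hi: "real T \<le> x" unfolding T_def using x1 xlo by linarith
    have T0: "T > 0" unfolding T_def using x1 xlo by linarith
    have fits: "1 + 2 * real N * real w * real T \<le> R * \<rho>"
      using T_hi N0 w1 by (simp add: x_def field_simps)
    have Lw: "2 * 9 ^ card (- I) * real w ^ card I \<le> real L ^ card (- I)"
    proof -
      have "2 * 9 ^ d \<le> 2 ^ d * (9::real) ^ d" using dn(2) self_le_power[of "2::real" d] by (intro mult_right_mono) auto
      also have "\<dots> = 18 ^ d" by (simp flip: power_mult_distrib)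
      finally have "2 * 9 ^ d * W ^ d \<le> 18 ^ d * W ^ d" using W1 by (intro mult_right_mono) auto
      also have "\<dots> = (18 * W) ^ d" by (simp add: power_mult_distrib)
      also have "\<dots> \<le> real L ^ d" using L_lo W1 by (intro power_mono) auto
      finally show ?thesis by (simp only: Wd I flip: d_def)
    qed
    have w0: "w > 0" using w1 by simp
    obtain \<Phi> where \<Phi>: "Ck_diffeo_on k UNIV UNIV \<Phi>"
      "\<And>is x. length is \<le> k \<Longrightarrow> norm (iter_partial is (\<lambda>y. \<Phi> y - y) x) \<le>
         real CARD('n) / R + real CARD('n) ^ 2 * \<alpha> +
         M ^ CARD('n) * (2 * R / (real N * real w)) ^ k * (real CARD('n) / (real L * R))"
      "real T ^ card I * real w ^ card I / (2 * real L ^ card (- I)) \<le> real (card (\<Phi> ` \<Sigma> \<inter> scaled_lattice R))"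
      by (rule many_lattice_points_at_scale[where I = I and c = c and N = N and w = w and T = T and L = L and k = k
            and R = R and \<rho> = \<rho> and \<alpha> = \<alpha> and M = M and b = b and \<Sigma> = \<Sigma>,
            OF b assms(5) \<rho> box N0 w0 T0 L0 R0 \<alpha>0 \<alpha>N fits Lw]) blast+
    have small: "M ^ CARD('n) * (2 * R / (real N * real w)) ^ k * (n / (real L * R)) \<le> \<epsilon> / 4"
    proof -
      have e1: "real k + real m / real d = D / real d" using dn(2) by (simp add: D_def field_simps)
      have "R ^ (k - 1) * K \<le> real w ^ k * W"
      proof -
        \<comment> \<open>The exponent \<open>D / d = k + m / d\<close> turns \<open>w\<close> into
          \<open>w ^ k * W\<close> and \<open>R powr \<theta>\<close> into
          \<open>R ^ (k - 1)\<close>.\<close>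
        have "(K * R powr \<theta>) powr (D / real d) \<le> real w powr (D / real d)"
          using w_lo KR D0 by (intro powr_mono2) auto
        also have "\<dots> = real w ^ k * W"
          using w1 by (simp add: W_def powr_add powr_realpow flip: e1)
        also have "(K * R powr \<theta>) powr (D / real d) = K powr (D / real d) * R powr (\<theta> * (D / real d))"
          using K1 by (simp add: powr_mult powr_powr)
        also have "\<theta> * (D / real d) = real (k - 1)" using D0 dn(2) assms(4) by (simp add: \<theta>_def of_nat_diff)
        also have "R powr real (k - 1) = R ^ (k - 1)" using R0 by (simp add: powr_realpow)
        finally have le: "K powr (D / real d) * R ^ (k - 1) \<le> real w ^ k * W" .
        have "1 \<le> D / real d"
          using e1 k1 by (metis add_increasing2 divide_nonneg_nonneg of_nat_0_le_iff of_nat_1 of_nat_mono)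
        then have "K powr 1 \<le> K powr (D / real d)" using K1 by (intro powr_mono) auto
        then have "K * R ^ (k - 1) \<le> K powr (D / real d) * R ^ (k - 1)" using K1 R0 by (intro mult_right_mono) auto
        then show ?thesis using le by (simp add: mult_ac)
      qed
      also have "\<dots> \<le> (real N * real w) ^ k * real L"
      proof (rule mult_mono)
        have "1 * real w \<le> real N * real w" using N0 by (intro mult_right_mono) auto
        then show "real w ^ k \<le> (real N * real w) ^ k" by (intro power_mono) auto
        show "W \<le> real L" using L_lo W1 by linarith
      qed (use W1 in auto)
      finally have le: "R ^ (k - 1) * K \<le> (real N * real w) ^ k * real L" .
      have Rk: "R ^ k = R * R ^ (k - 1)" using k1 by (metis Suc_diff_le diff_Suc_1 power_Suc One_nat_def le_add_diff_inverse plus_1_eq_Suc)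
      define H where "H = M ^ CARD('n) * 2 ^ k * n"
      have H0: "H > 0" using b(6) n2 by (simp add: H_def)
      have den: "(real N * real w) ^ k * real L > 0" using N0 w0 L0 by simp
      have "M ^ CARD('n) * (2 * R / (real N * real w)) ^ k * (n / (real L * R)) = H * (R ^ (k - 1) / ((real N * real w) ^ k * real L))"
        using R0 unfolding power_divide power_mult_distrib[of 2 R] Rk by (simp add: H_def)
      also have "R ^ (k - 1) / ((real N * real w) ^ k * real L) \<le> 1 / K"
        using le den K1 by (simp add: field_simps)
      also have "H * (1 / K) \<le> \<epsilon> / 4"
      proof -
        have "4 * H / \<epsilon> \<le> K" by (simp add: K_def H_def mult_ac)
        then show ?thesis using assms(8) K1 by (simp add: field_simps)
      qed
      finally show ?thesis using H0 by simp
    qed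
    have nR: "n / R \<le> \<epsilon> / 4" using R1(2) R0 assms(8) by (simp add: field_simps)
    have na: "n ^ 2 * \<alpha> = \<epsilon> / 4" using n2 by (simp add: \<alpha>_def)
    have "Ck_close k \<epsilon> \<Sigma> (\<Phi> ` \<Sigma>)"
      unfolding Ck_close_def
    \<comment> \<open>Translation, sines and bumps cost at most \<open>\<epsilon> / 4\<close> each,
      which leaves room for the strict inequality.\<close>
    proof (intro exI[of _ \<Phi>] exI[of _ "3 * \<epsilon> / 4"] conjI allI impI)
      fix "is" :: "'n list" and x assume "length is \<le> k"
      from \<Phi>(2)[OF this, of x] show "norm (iter_partial is (\<lambda>y. \<Phi> y - y) x) \<le> 3 * \<epsilon> / 4"
        using small nR na unfolding n_def by linarith
    qed (use \<Phi>(1) assms(8) in auto)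
    moreover have "Ck_submanifold k m (\<Phi> ` \<Sigma>)" by (rule Ck_submanifold_image[OF assms(7) \<Phi>(1)])
    moreover have "c' * R powr (real m * real CARD('n) / (real m + real k * (real CARD('n) - real m)))
         \<le> real (card (\<Phi> ` \<Sigma> \<inter> scaled_lattice R))"
    proof -
      have ex: "real m * real CARD('n) / (real m + real k * (real CARD('n) - real m)) = (1 - \<theta>) * real m"
        unfolding \<theta>1 D_def dn(1) by (simp add: n_def mult_ac add_ac)
      have "(\<kappa> / 2) ^ m * R powr ((1 - \<theta>) * real m) = (\<kappa> / 2 * R powr (1 - \<theta>)) ^ m"
      proof -
        have "R powr ((1 - \<theta>) * real m) = (R powr (1 - \<theta>)) ^ m"
          using R0 by (simp add: powr_realpow flip: powr_powr)
        then show ?thesis by (simp only: power_mult_distrib)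
      qed
      also have "\<dots> \<le> real T ^ m" using T_lo \<kappa>0 by (intro power_mono) auto
      finally have "c' * R powr ((1 - \<theta>) * real m) \<le> real T ^ m / (2 * 19 ^ d)"
        unfolding c'_def by (simp add: field_simps)
      also have "\<dots> = real T ^ m * real w ^ m / (2 * (19 * W) ^ d)"
        using w0 by (simp add: power_mult_distrib Wd)
      also have "\<dots> \<le> real T ^ m * real w ^ m / (2 * real L ^ d)"
        using L_hi L0 by (intro divide_left_mono mult_left_mono power_mono mult_pos_pos zero_less_power) (use W1 in auto)
      also have "\<dots> \<le> real (card (\<Phi> ` \<Sigma> \<inter> scaled_lattice R))" using \<Phi>(3) by (simp only: I flip: d_def)
      finally show ?thesis unfolding ex .
    qed
    ultimately show ?thesis by blast
  qed
  have "C > 0" by (auto simp: C_def less_max_iff_disj)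
  moreover have "c' > 0" using \<kappa>0 by (simp add: c'_def)
  ultimately show ?thesis using main by blast
qed

end
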